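(* Let $\lambda,\mu,\nu$ be partitions of the same integer with $\ell(\lambda)\le 4$, $\ell(\mu),\ell(\nu)\le 2$, and $\mu_2\ge\nu_2$. Let $$P_\lambda(x,y)=y^{\lambda_3+\lambda_4}\big(x^{\lambda_2+\lambda_4}-x^{\lambda_2+\lambda_3+1}-x^{\lambda_1+\lambda_4+1}+x^{\lambda_1+\lambda_3+2}\big)+y^{\lambda_2+\lambda_4+1}\big(-x^{\lambda_3+\lambda_4-1}+x^{\lambda_2+\lambda_3+1}+x^{\lambda_1+\lambda_4+1}\big).$$ Then: (1) The Kronecker coefficient $g_{\mu,\nu,\lambda}$ equals the coefficient of $x^{\mu_2}y^{\nu_2}$ in the Laurent series $P_\lambda(x,y)\bar F_{2,2}(x,y)$. Moreover, a monomial $y^bx^a$ of $P_\lambda$ contributes a nonzero amount to this coefficient (i.e. the coefficient of $x^{\mu_2-a}y^{\nu_2-b}$ in $\bar F_{2,2}$ is nonzero) if and only if $b\le\nu_2$ and $a+b\le\mu_2+\nu_2$. (2) Explicitly, \begin{align*} g_{\mu,\nu,\lambda}=\;& p_S(\nu_2-(\lambda_3+\lambda_4),\ \nu_2-(\lambda_3+\lambda_4)+\mu_2-(\lambda_2+\lambda_4))\\ &-p_S(\nu_2-(\lambda_3+\lambda_4),\ \nu_2-(\lambda_3+\lambda_4)+\mu_2-(\lambda_2+\lambda_3+1))\\ &-p_S(\nu_2-(\lambda_3+\lambda_4),\ \nu_2-(\lambda_3+\lambda_4)+\mu_2-(\lambda_1+\lambda_4+1))\\ &+p_S(\nu_2-(\lambda_3+\lambda_4),\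 \nu_2-(\lambda_3+\lambda_4)+\mu_2-(\lambda_1+\lambda_3+2))\\ &-p_S(\nu_2-(\lambda_2+\lambda_4+1),\ \nu_2-(\lambda_2+\lambda_4+1)+\mu_2-(\lambda_3+\lambda_4-1))\\ &+p_S(\nu_2-(\lambda_2+\lambda_4+1),\ \nu_2-(\lambda_2+\lambda_4+1)+\mu_2-(\lambda_2+\lambda_3+1))\\ &+p_S(\nu_2-(\lambda_2+\lambda_4+1),\ \nu_2-(\lambda_2+\lambda_4+1)+\mu_2-(\lambda_1+\lambda_4+1)). \end{align*}
   Context: Partitions are padded with zero parts. For partitions $\mu,\nu,\lambda$ of the same integer with $\ell(\mu)\le n$, $\ell(\nu)\le m$, $\ell(\lambda)\le nm$, the Kronecker coefficient $g_{\mu,\nu,\lambda}$ is defined by $s_\lambda(x_1y_1,x_1y_2,\dots,x_ny_m)=\sum_{\mu,\nu}g_{\mu,\nu,\lambda}\,s_\mu(x_1,\dots,x_n)s_\nu(y_1,\dots,y_m)$, where $s$ denotes Schur polynomials (here $n=m=2$). $\bar F_{2,2}(x,y)=1/((1-y/x)(1-xy)(1-x)(1-y))$, expanded as a Laurent series in the domain $0<|xy|<|y|<|x|<1$ (each factor $(1-M)^{-1}$ expanded as $\sum_{k\ge0}M^k$). For integers $n,m$, $p_S(n,m)$ is the number of $(x_1,\dots,x_4)\in\mathbb{Z}_{\ge0}^4$ with $x_1+x_3+x_4=n$, $x_2+x_3+2x_4=m$ (zero if $n<0$ or $m<0$); it is the coefficient of $s_0^ns_1^m$ in $1/((1-s_0)(1-s_1)(1-s_0s_1)(1-s_0s_1^2))$.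 *)

theory Defs
  imports Main
begin

text \<open>Young diagrams: a partition with at most k parts is a weakly decreasing
  list of length k (padded with zero parts). Rows and columns are indexed from 0.\<close>

definition partitions :: "nat \<Rightarrow> nat \<Rightarrow> nat list set" where
  "partitions k d = {p. length p = k \<and> sorted_wrt (\<ge>) p \<and> sum_list p = d}"

definition cells :: "nat list \<Rightarrow> (nat \<times> nat) set" where
  "cells p = {(i, j). i < length p \<and> j < p ! i}"

definition ssyt :: "nat list \<Rightarrow> nat \<Rightarrow> (nat \<Rightarrow> nat \<Rightarrow> nat) set" where
  "ssyt p N = {T.
     (\<forall>i j. (i, j) \<in> cells p \<longrightarrow> T i j < N) \<and>
     (\<forall>i j. (i, j) \<notin> cells p \<longrightarrow> T i j = 0) \<and>
     (\<forall>i j. (i, Suc j) \<in> cells p \<longrightarrow> T i j \<le> T i (Suc j)) \<and>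
     (\<forall>i j. (Suc i, j) \<in> cells p \<longrightarrow> T i j < T (Suc i) j)}"

text \<open>Coefficient of z_0^(a 0) ... z_(N-1)^(a (N-1)) in the Schur polynomial
  s_p(z_0,...,z_(N-1)) = sum over SSYT T of z^T (Kostka number).\<close>
definition schur_coeff :: "nat list \<Rightarrow> nat \<Rightarrow> (nat \<Rightarrow> nat) \<Rightarrow> nat" where
  "schur_coeff p N a =
     card {T \<in> ssyt p N. \<forall>k<N. card {c \<in> cells p. T (fst c) (snd c) = k} = a k}"

text \<open>Coefficient of x^a y^b in s_p(x_0 y_0, x_0 y_1, ..., x_(n-1) y_(m-1)), where the
  variable z_k is substituted by x_(k div m) y_(k mod m).\<close>
definition schur_subst_coeff ::
  "nat list \<Rightarrow> nat \<Rightarrow> nat \<Rightarrow> (nat \<Rightarrow> nat) \<Rightarrow> (nat \<Rightarrow> nat) \<Rightarrow> nat" where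
  "schur_subst_coeff p n m a b =
     card {T \<in> ssyt p (n * m).
        (\<forall>i<n. card {c \<in> cells p. T (fst c) (snd c) div m = i} = a i) \<and>
        (\<forall>j<m. card {c \<in> cells p. T (fst c) (snd c) mod m = j} = b j)}"

text \<open>Kronecker coefficient g_{mu,nu,lambda}: the (unique) coefficients in
  s_lambda(x_i y_j) = sum_{mu,nu} g_{mu,nu,lambda} s_mu(x) s_nu(y),
  mu, nu ranging over partitions of |lambda| with at most n resp. m parts.\<close>
definition kron :: "nat \<Rightarrow> nat \<Rightarrow> nat list \<Rightarrow> nat list \<Rightarrow> nat list \<Rightarrow> int" where
  "kron n m mu nu lam =
     (THE (g :: nat list \<Rightarrow> nat list \<Rightarrow> int).
        (\<forall>mu' nu'. mu' \<notin> partitions n (sum_list lam) \<or> nu' \<notin> partitions m (sum_list lam)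
                 \<longrightarrow> g mu' nu' = 0) \<and>
        (\<forall>a b. int (schur_subst_coeff lam n m a b) =
           (\<Sum>mu'\<in>partitions n (sum_list lam). \<Sum>nu'\<in>partitions m (sum_list lam).
              g mu' nu' * int (schur_coeff mu' n a) * int (schur_coeff nu' m b))))
     mu nu"

text \<open>Coefficient of x^i y^j in the Laurent expansion of
  1/((1-y/x)(1-xy)(1-x)(1-y)) = sum_{k1,k2,k3,k4} (y/x)^k1 (xy)^k2 x^k3 y^k4.\<close>
definition Fbar_coeff :: "int \<Rightarrow> int \<Rightarrow> nat" where
  "Fbar_coeff i j = card {(k1, k2, k3, k4).
       - int (k1::nat) + int (k2::nat) + int (k3::nat) = i \<and> int k1 + int k2 + int (k4::nat) = j}"

definition pS :: "int \<Rightarrow> int \<Rightarrow> nat" where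
  "pS n m = (if n < 0 \<or> m < 0 then 0 else
     card {(x1, x2, x3, x4).
       int (x1::nat) + int (x3::nat) + int (x4::nat) = n \<and> int (x2::nat) + int x3 + 2 * int x4 = m})"

text \<open>The Laurent polynomial P_lambda as a list of terms (c, a, b) meaning c * x^a * y^b.\<close>
definition Plam :: "nat \<Rightarrow> nat \<Rightarrow> nat \<Rightarrow> nat \<Rightarrow> (int \<times> int \<times> int) list" where
  "Plam l1 l2 l3 l4 =
    [( 1, int l2 + int l4,     int l3 + int l4),
     (-1, int l2 + int l3 + 1, int l3 + int l4),
     (-1, int l1 + int l4 + 1, int l3 + int l4),
     ( 1, int l1 + int l3 + 2, int l3 + int l4),
     (-1, int l3 + int l4 - 1, int l2 + int l4 + 1),
     ( 1, int l2 + int l3 + 1, int l2 + int l4 + 1),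
     ( 1, int l1 + int l4 + 1, int l2 + int l4 + 1)]"

end

theory Submission
  imports Defs "HOL-Computational_Algebra.Formal_Power_Series"
begin

text \<open>
  Removing the cells with the largest entry from a semistandard tableau gives the branching rule,
  from which the bialternant formula in four variables follows: at each step a determinant of
  geometric sums is evaluated row by row.

  At \<open>(x\<^sub>0, x\<^sub>1; y\<^sub>0, y\<^sub>1) = (1, X; 1, UX)\<close>, i.e. \<open>U = y/x\<close>, the Vandermonde product of the
  letters \<open>x\<^sub>i y\<^sub>j\<close> becomes \<open>- U X\<^sup>3 (1 - X) (1 - UX)\<close> times the denominator of the generating
  function of \<open>p\<^sub>S\<close>.  The factors \<open>(1 - X) (1 - UX)\<close> turn the coefficients of \<open>s\<^sub>\<lambda>(x\<^sub>i y\<^sub>j)\<close> into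
  their mixed second difference, which is the Kronecker coefficient because two-variable Kostka
  numbers are 0 or 1.  Hence the Kronecker coefficient is a signed sum of 24 values of \<open>p\<^sub>S\<close>.
  For \<open>\<nu>\<^sub>2 \<le> \<mu>\<^sub>2 \<le> |\<lambda>|/2\<close>, 13 of them vanish and the remaining four outside \<open>P\<^sub>\<lambda>\<close> cancel in pairs,
  since \<open>p\<^sub>S(n, m)\<close> does not depend on \<open>m\<close> as soon as \<open>m \<ge> 2n\<close>.
\<close>

section \<open>Schur polynomials and the branching rule\<close>

definition tab_weight :: "nat list \<Rightarrow> (nat \<Rightarrow> 'a::comm_ring_1) \<Rightarrow> (nat \<Rightarrow> nat \<Rightarrow> nat) \<Rightarrow> 'a" where
  "tab_weight p z T = (\<Prod>c\<in>cells p. z (T (fst c) (snd c)))"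

definition schur :: "nat list \<Rightarrow> nat \<Rightarrow> (nat \<Rightarrow> 'a::comm_ring_1) \<Rightarrow> 'a" where
  "schur p N z = (\<Sum>T\<in>ssyt p N. tab_weight p z T)"

text \<open>The shapes \<open>q\<close> for which p/q is a horizontal strip, encoded by interlacing.
  Zero parts are kept, so the last part of \<open>q\<close> is bounded only from above.\<close>

definition strips :: "nat list \<Rightarrow> nat list set" where
  "strips p = {q. length q = length p \<and>
     (\<forall>i<length p. q ! i \<le> p ! i \<and> (Suc i < length p \<longrightarrow> p ! Suc i \<le> q ! i))}"

lemma cells_altdef: "cells p = Sigma {..<length p} (\<lambda>i. {..<p ! i})"
  by (auto simp: cells_def)

lemma in_cells [simp]: "(i, j) \<in> cells p \<longleftrightarrow> i < length p \<and> j < p ! i"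
  by (simp add: cells_def)

lemma finite_cells [simp]: "finite (cells p)"
  by (simp add: cells_altdef)

lemma card_cells: "card (cells p) = sum_list p"
  by (simp add: cells_altdef sum_list_sum_nth atLeast0LessThan)

lemma card_cells_not:
  "card {c \<in> cells p. \<not> P c} = sum_list p - card {c \<in> cells p. P c}"
proof -
  have "{c \<in> cells p. \<not> P c} = cells p - {c \<in> cells p. P c}" by auto
  then show ?thesis by (simp add: card_Diff_subset card_cells)
qed

lemma ssyt_lt: "T \<in> ssyt p N \<Longrightarrow> i < length p \<Longrightarrow> j < p ! i \<Longrightarrow> T i j < N"
  by (auto simp: ssyt_def)

lemma ssyt_outside: "T \<in> ssyt p N \<Longrightarrow> \<not> (i < length p \<and> j < p ! i) \<Longrightarrow> T i j = 0"
  by (auto simp: ssyt_def)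

lemma ssyt_row: "T \<in> ssyt p N \<Longrightarrow> i < length p \<Longrightarrow> Suc j < p ! i \<Longrightarrow> T i j \<le> T i (Suc j)"
  by (auto simp: ssyt_def)

lemma ssyt_col: "T \<in> ssyt p N \<Longrightarrow> Suc i < length p \<Longrightarrow> j < p ! Suc i \<Longrightarrow> T i j < T (Suc i) j"
  by (auto simp: ssyt_def)

lemma ssyt_row_mono:
  assumes "T \<in> ssyt p N" "i < length p" "j \<le> k" "k < p ! i"
  shows "T i j \<le> T i k"
  using assms(3,4)
proof (induction k rule: dec_induct)
  case (step k)
  then show ?case using ssyt_row[OF assms(1,2), of k] by simp
qed simp

lemma finite_ssyt: "finite (ssyt p N)"
proof -
  let ?F = "{f :: nat \<times> nat \<Rightarrow> nat. \<forall>c. (c \<in> cells p \<longrightarrow> f c \<in> {..<N}) \<and> (c \<notin> cells p \<longrightarrow> f c = 0)}"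
  have "finite ?F" by (rule finite_set_of_finite_funs) auto
  moreover have "ssyt p N \<subseteq> curry ` ?F"
  proof
    fix T assume "T \<in> ssyt p N"
    then have "case_prod T \<in> ?F" by (auto simp: ssyt_def)
    moreover have "T = curry (case_prod T)" by simp
    ultimately show "T \<in> curry ` ?F" by blast
  qed
  ultimately show ?thesis by (meson finite_imageI finite_subset)
qed

text \<open>Such a set is an initial segment ending just before its least non-member, which
  therefore equals the cardinality.\<close>

lemma downset_card:
  fixes P :: "nat \<Rightarrow> bool"
  assumes "\<And>j k. j \<le> k \<Longrightarrow> P k \<Longrightarrow> P j" and "finite {j. P j}"
  shows "P j \<longleftrightarrow> j < card {j. P j}"
proof -
  obtain n where n: "\<not> P n"
    using assms(2) by (metis (full_types) UNIV_eq_I infinite_UNIV_nat mem_Collect_eq)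
  define m where "m = (LEAST n. \<not> P n)"
  have m: "\<not> P m" unfolding m_def by (rule LeastI[of _ n]) (use n in simp)
  have "P j \<longleftrightarrow> j < m" for j
    using assms(1)[of m j] m not_less_Least[of j "\<lambda>n. \<not> P n"] unfolding m_def[symmetric]
    by (cases "j < m") auto
  then have "{j. P j} = {..<m}" by auto
  then show ?thesis by (metis card_lessThan lessThan_iff mem_Collect_eq)
qed

section \<open>Removing the largest letter from a tableau\<close>

definition strip_row :: "nat list \<Rightarrow> nat \<Rightarrow> (nat \<Rightarrow> nat \<Rightarrow> nat) \<Rightarrow> nat \<Rightarrow> nat" where
  "strip_row p N T i = card {j. j < p ! i \<and> T i j < N}"

lemma strip_row_iff:
  assumes "T \<in> ssyt p (Suc N)" "i < length p"
  shows "j < strip_row p N T i \<longleftrightarrow> j < p ! i \<and> T i j < N"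
  unfolding strip_row_def
proof (rule downset_card[of "\<lambda>j. j < p ! i \<and> T i j < N", symmetric])
  fix j k assume "j \<le> k" "k < p ! i \<and> T i k < N"
  then show "j < p ! i \<and> T i j < N"
    using ssyt_row_mono[OF assms, of j k] by simp
qed simp

definition tab_extend :: "nat list \<Rightarrow> nat \<Rightarrow> nat list \<Rightarrow> (nat \<Rightarrow> nat \<Rightarrow> nat) \<Rightarrow> nat \<Rightarrow> nat \<Rightarrow> nat" where
  "tab_extend p N q T i j = (if (i, j) \<in> cells p - cells q then N else T i j)"

text \<open>The default 0 is the value that \<open>ssyt\<close> prescribes off the shape, so
  restriction and extension are inverse as functions.\<close>

definition tab_restrict :: "nat \<Rightarrow> (nat \<Rightarrow> nat \<Rightarrow> nat) \<Rightarrow> nat \<Rightarrow> nat \<Rightarrow> nat" where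
  "tab_restrict N T i j = (if T i j < N then T i j else 0)"

definition strip_shape :: "nat list \<Rightarrow> nat \<Rightarrow> (nat \<Rightarrow> nat \<Rightarrow> nat) \<Rightarrow> nat list" where
  "strip_shape p N T = map (strip_row p N T) [0..<length p]"

lemma strip_shape_simps [simp]:
  "length (strip_shape p N T) = length p"
  "i < length p \<Longrightarrow> strip_shape p N T ! i = strip_row p N T i"
  by (simp_all add: strip_shape_def)

lemma partition_Suc_le:
  assumes "sorted_wrt (\<ge>) p" "Suc i < length p"
  shows "p ! Suc i \<le> (p ! i :: nat)"
  using sorted_wrt_nth_less[OF assms(1), of i "Suc i"] assms(2) by simp

lemma strip_shape_in_strips:
  assumes "sorted_wrt (\<ge>) p" "T \<in> ssyt p (Suc N)"
  shows "strip_shape p N T \<in> strips p"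
proof -
  have "strip_row p N T i \<le> p ! i" if "i < length p" for i
    using strip_row_iff[OF assms(2) that, of "p ! i"] by (simp add: not_less)
  moreover have "p ! Suc i \<le> strip_row p N T i" if "Suc i < length p" for i
  proof (rule ccontr)
    \<comment> \<open>Otherwise the first removed cell of row \<open>i\<close> has a cell of
      \<open>p\<close> below it. That entry is at most \<open>N\<close>, so the strict column puts
      an entry less than \<open>N\<close> above it, and the cell would not have been
      removed.\<close>
    assume "\<not> ?thesis"
    then have lt: "strip_row p N T i < p ! Suc i" by simp
    let ?j = "strip_row p N T i"
    have "?j < p ! i" using lt partition_Suc_le[OF assms(1) that] by simp
    moreover have "T i ?j < N"
      using ssyt_col[OF assms(2) that lt] ssyt_lt[OF assms(2) that lt] by simp
    ultimately show False using strip_row_iff[OF assms(2), of i ?j] that by simp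
  qed
  ultimately show ?thesis by (auto simp: strips_def)
qed

lemma tab_restrict_ssyt:
  assumes "sorted_wrt (\<ge>) p" "T \<in> ssyt p (Suc N)"
  shows "tab_restrict N T \<in> ssyt (strip_shape p N T) N"
proof -
  have q: "p ! Suc i \<le> strip_row p N T i" if "Suc i < length p" for i
    using strip_shape_in_strips[OF assms] that by (auto simp: strips_def)
  have le: "strip_row p N T i \<le> p ! i" if "i < length p" for i
    using strip_shape_in_strips[OF assms] that by (auto simp: strips_def)
  note iff = strip_row_iff[OF assms(2)]
  have col: "tab_restrict N T i j < tab_restrict N T (Suc i) j"
    if "Suc i < length p" "j < strip_row p N T (Suc i)" for i j
  proof -
    have "j < p ! Suc i" using that le[of "Suc i"] by simp
    then have "j < strip_row p N T i" using q[of i] that by simp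
    then show ?thesis
      using that iff[of i j] iff[of "Suc i" j] ssyt_col[OF assms(2) that(1)]
      by (simp add: tab_restrict_def)
  qed
  have row: "tab_restrict N T i j \<le> tab_restrict N T i (Suc j)"
    if "i < length p" "Suc j < strip_row p N T i" for i j
    using that iff[of i j] iff[of i "Suc j"] ssyt_row[OF assms(2) that(1), of j]
    by (simp add: tab_restrict_def)
  have out: "tab_restrict N T i j = 0" if "\<not> (i < length p \<and> j < strip_row p N T i)" for i j
    using that iff[of i j] ssyt_outside[OF assms(2), of i j]
    by (auto simp: tab_restrict_def)
  have inn: "tab_restrict N T i j < N" if "i < length p" "j < strip_row p N T i" for i j
    using that iff[of i j] by (simp add: tab_restrict_def)
  show ?thesis
    unfolding ssyt_def using row col inn out by auto
qed

lemma tab_extend_ssyt: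
  assumes "q \<in> strips p" "T \<in> ssyt q N"
  shows "tab_extend p N q T \<in> ssyt p (Suc N)"
proof -
  have len: "length q = length p" and le: "\<And>i. i < length p \<Longrightarrow> q ! i \<le> p ! i"
    and ge: "\<And>i. Suc i < length p \<Longrightarrow> p ! Suc i \<le> q ! i"
    using assms(1) by (auto simp: strips_def)
  note lt = ssyt_lt[OF assms(2), unfolded len] and out = ssyt_outside[OF assms(2), unfolded len]
    and row = ssyt_row[OF assms(2), unfolded len] and col = ssyt_col[OF assms(2), unfolded len]
  have 1: "tab_extend p N q T i j < Suc N" if "i < length p" "j < p ! i" for i j
    using lt[of i j] that by (auto simp: tab_extend_def len)
  have 2: "tab_extend p N q T i j = 0" if "\<not> (i < length p \<and> j < p ! i)" for i j
    using out[of i j] that le[of i] by (cases "i < length p") (auto simp: tab_extend_def len)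
  have 3: "tab_extend p N q T i j \<le> tab_extend p N q T i (Suc j)"
    if "i < length p" "Suc j < p ! i" for i j
    using row[of i j] lt[of i j] that by (auto simp: tab_extend_def len)
  \<comment> \<open>Interlacing puts the cell above any cell of row \<open>Suc i\<close> inside
    \<open>q\<close>, where entries are below \<open>N\<close>; hence no column receives
    \<open>N\<close> twice.\<close>
  have 4: "tab_extend p N q T i j < tab_extend p N q T (Suc i) j"
    if "Suc i < length p" "j < p ! Suc i" for i j
    using col[of i j] lt[of i j] that ge[of i] by (auto simp: tab_extend_def len)
  show ?thesis
    unfolding ssyt_def using 1 2 3 4 by auto
qed

lemma strip_shape_extend:
  assumes "q \<in> strips p" "T \<in> ssyt q N"
  shows "strip_shape p N (tab_extend p N q T) = q"
proof (rule nth_equalityI)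
  show "length (strip_shape p N (tab_extend p N q T)) = length q"
    using assms by (simp add: strips_def)
next
  fix i assume "i < length (strip_shape p N (tab_extend p N q T))"
  then have i: "i < length p" by simp
  have len: "length q = length p" and le: "q ! i \<le> p ! i"
    using assms(1) i by (auto simp: strips_def)
  have "{j. j < p ! i \<and> tab_extend p N q T i j < N} = {..<q ! i}"
    using ssyt_lt[OF assms(2)] i le by (auto simp: tab_extend_def len split: if_splits)
  then show "strip_shape p N (tab_extend p N q T) ! i = q ! i"
    using i by (simp add: strip_row_def)
qed

lemma tab_restrict_extend:
  assumes "q \<in> strips p" "T \<in> ssyt q N"
  shows "tab_restrict N (tab_extend p N q T) = T"
proof (intro ext)
  fix i j
  show "tab_restrict N (tab_extend p N q T) i j = T i j"
    using ssyt_lt[OF assms(2), of i j] ssyt_outside[OF assms(2), of i j] assms(1)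
    by (auto simp: tab_restrict_def tab_extend_def strips_def)
qed

lemma tab_extend_restrict:
  assumes "T \<in> ssyt p (Suc N)"
  shows "tab_extend p N (strip_shape p N T) (tab_restrict N T) = T"
proof (intro ext)
  fix i j
  show "tab_extend p N (strip_shape p N T) (tab_restrict N T) i j = T i j"
    using ssyt_lt[OF assms, of i j] ssyt_outside[OF assms, of i j] strip_row_iff[OF assms, of i j]
    by (cases "i < length p \<and> j < p ! i") (auto simp: tab_restrict_def tab_extend_def)
qed

lemma tab_weight_extend:
  assumes "q \<in> strips p"
  shows "tab_weight p z (tab_extend p N q T) = z N ^ (sum_list p - sum_list q) * tab_weight q z T"
proof -
  have sub: "cells q \<subseteq> cells p"
    using assms by (force simp: strips_def cells_def)
  have "tab_weight p z (tab_extend p N q T) =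
      (\<Prod>c\<in>cells p - cells q. z (tab_extend p N q T (fst c) (snd c))) *
      (\<Prod>c\<in>cells q. z (tab_extend p N q T (fst c) (snd c)))"
    unfolding tab_weight_def by (rule prod.subset_diff[OF sub]) simp
  also have "(\<Prod>c\<in>cells p - cells q. z (tab_extend p N q T (fst c) (snd c))) =
      (\<Prod>c\<in>cells p - cells q. z N)"
    by (rule prod.cong) (auto simp: tab_extend_def)
  also have "\<dots> = z N ^ (sum_list p - sum_list q)"
    using sub by (simp add: card_Diff_subset card_cells)
  also have "(\<Prod>c\<in>cells q. z (tab_extend p N q T (fst c) (snd c))) = tab_weight q z T"
    unfolding tab_weight_def by (rule prod.cong) (auto simp: tab_extend_def)
  finally show ?thesis .
qed

lemma finite_strips: "finite (strips p)"
proof (rule finite_subset)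
  show "strips p \<subseteq> {q. set q \<subseteq> {..sum_list p} \<and> length q = length p}"
    by (auto simp: strips_def in_set_conv_nth)
      (metis elem_le_sum_list le_trans)
  show "finite \<dots>" by (rule finite_lists_length_eq) simp
qed

text \<open>A tableau corresponds bijectively to the shape of its entries below \<open>N\<close>
  together with the tableau on that shape; each removed cell contributes a factor
  \<open>z N\<close>.\<close>

lemma schur_branching:
  assumes "sorted_wrt (\<ge>) p"
  shows "schur p (Suc N) z =
    (\<Sum>q\<in>strips p. z N ^ (sum_list p - sum_list q) * schur q N z)"
proof -
  have "schur p (Suc N) z =
      (\<Sum>(q, T)\<in>Sigma (strips p) (\<lambda>q. ssyt q N). z N ^ (sum_list p - sum_list q) * tab_weight q z T)"
    unfolding schur_def
  proof (rule sum.reindex_bij_witness[of _ "\<lambda>(q, T). tab_extend p N q T"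
        "\<lambda>T. (strip_shape p N T, tab_restrict N T)"])
    fix T assume T: "T \<in> ssyt p (Suc N)"
    show "(case (strip_shape p N T, tab_restrict N T) of (q, T) \<Rightarrow> tab_extend p N q T) = T"
      using tab_extend_restrict[OF T] by simp
    show "(strip_shape p N T, tab_restrict N T) \<in> Sigma (strips p) (\<lambda>q. ssyt q N)"
      using strip_shape_in_strips[OF assms T] tab_restrict_ssyt[OF assms T] by simp
    show "(case (strip_shape p N T, tab_restrict N T) of
        (q, T) \<Rightarrow> z N ^ (sum_list p - sum_list q) * tab_weight q z T) = tab_weight p z T"
      using tab_weight_extend[OF strip_shape_in_strips[OF assms T], of z N "tab_restrict N T"]
      by (simp add: tab_extend_restrict[OF T])
  next
    fix qT assume "qT \<in> Sigma (strips p) (\<lambda>q. ssyt q N)"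
    then obtain q T where [simp]: "qT = (q, T)" and q: "q \<in> strips p" and T: "T \<in> ssyt q N"
      by auto
    show "(strip_shape p N (case qT of (q, T) \<Rightarrow> tab_extend p N q T),
        tab_restrict N (case qT of (q, T) \<Rightarrow> tab_extend p N q T)) = qT"
      using strip_shape_extend[OF q T] tab_restrict_extend[OF q T] by simp
    show "(case qT of (q, T) \<Rightarrow> tab_extend p N q T) \<in> ssyt p (Suc N)"
      using tab_extend_ssyt[OF q T] by simp
  qed
  also have "\<dots> = (\<Sum>q\<in>strips p. \<Sum>T\<in>ssyt q N. z N ^ (sum_list p - sum_list q) * tab_weight q z T)"
    by (rule sum.Sigma[symmetric]) (auto simp: finite_strips finite_ssyt)
  finally show ?thesis by (simp add: schur_def sum_distrib_left)
qed


section \<open>Schur polynomials of up to four rows as nested sums\<close>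

lemma sum_strips_singleton: "sum f (strips [a]) = (\<Sum>x\<le>a. f [x])"
  by (rule sum.reindex_bij_witness[of _ "\<lambda>x. [x]" hd])
    (auto simp: strips_def length_Suc_conv)

text \<open>Interlacing confines each part of \<open>q\<close> to an interval fixed by
  \<open>p\<close> alone, so the parts can be summed independently.\<close>

lemma sum_strips_Cons:
  "sum f (strips (a # b # p)) = (\<Sum>x=b..a. \<Sum>q\<in>strips (b # p). f (x # q))"
proof -
  have mem: "x # q \<in> strips (a # b # p) \<longleftrightarrow> x \<in> {b..a} \<and> q \<in> strips (b # p)" for x q
    by (auto simp: strips_def All_less_Suc2)
  have ne: "q \<noteq> []" if "q \<in> strips (a # b # p)" for q
    using that by (auto simp: strips_def)
  have "sum f (strips (a # b # p)) = (\<Sum>(x, q)\<in>{b..a} \<times> strips (b # p). f (x # q))"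
  proof (rule sum.reindex_bij_witness[of _ "\<lambda>(x, q). x # q" "\<lambda>q. (hd q, tl q)"])
    fix q assume "q \<in> strips (a # b # p)"
    then show "(hd q, tl q) \<in> {b..a} \<times> strips (b # p)"
      using mem[of "hd q" "tl q"] ne[of q] by simp
  qed (use mem ne in auto)
  then show ?thesis by (simp add: sum.cartesian_product)
qed

lemma ssyt_first_column_ge:
  assumes "sorted_wrt (\<ge>) p" "T \<in> ssyt p N" "i < length p" "0 < p ! i"
  shows "i \<le> T i 0"
  using assms(3,4)
proof (induction i)
  case (Suc i)
  then have "i \<le> T i 0" using partition_Suc_le[OF assms(1), of i] by simp
  then show ?case using ssyt_col[OF assms(2), of i 0] Suc.prems by simp
qed simp

text \<open>Strict columns force the first entry of row \<open>N\<close> to be at least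
  \<open>N\<close>, outside the alphabet. In the branching rule this removes all shapes whose last
  part is positive.\<close>

lemma schur_too_many_rows:
  assumes "sorted_wrt (\<ge>) p" "N < length p" "0 < p ! N"
  shows "schur p N z = 0"
proof -
  have "ssyt p N = {}"
    using ssyt_first_column_ge[OF assms(1) _ assms(2,3)] ssyt_lt[OF _ assms(2,3)]
    by (metis ex_in_conv not_less)
  then show ?thesis by (simp add: schur_def)
qed

lemma schur_append_0: "schur (p @ [0]) N z = schur p N z"
proof -
  have "cells (p @ [0]) = cells p"
    by (auto simp: cells_def nth_append less_Suc_eq split: if_splits)
  then show ?thesis by (simp add: schur_def ssyt_def tab_weight_def)
qed

lemma sum_atMost_eq_first:
  fixes f :: "nat \<Rightarrow> 'a::comm_monoid_add"
  assumes "\<And>x. 0 < x \<Longrightarrow> x \<le> n \<Longrightarrow> f x = 0"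
  shows "sum f {..n} = f 0"
  using assms by (induction n) auto

lemma schur_Nil: "schur [] 0 z = 1"
proof -
  have "ssyt [] 0 = {\<lambda>_ _. 0}" by (auto simp: ssyt_def cells_def)
  then show ?thesis by (simp add: schur_def tab_weight_def cells_def)
qed

lemma schur_1: "schur [p1] 1 z = z 0 ^ p1"
proof -
  have "schur [p1] (Suc 0) z = (\<Sum>q\<le>p1. z 0 ^ (p1 - q) * schur [q] 0 z)"
    by (subst schur_branching) (simp_all add: sum_strips_singleton)
  also have "\<dots> = z 0 ^ p1 * schur [0] 0 z"
    by (subst sum_atMost_eq_first) (auto simp: schur_too_many_rows)
  finally show ?thesis using schur_append_0[of "[]" 0 z] by (simp add: schur_Nil)
qed

text \<open>One branching step: a positive last part \<open>x\<close> would leave two rows for one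
  letter, so only \<open>x = 0\<close> survives. The power of the last letter is split by rows to
  expose geometric sums. Three and four rows follow the same pattern.\<close>

lemma schur_2:
  assumes "p2 \<le> p1"
  shows "schur [p1, p2] 2 z = (\<Sum>q=p2..p1. z 0 ^ q * z 1 ^ (p1 - q) * z 1 ^ p2)"
proof -
  have "schur [p1, p2] (Suc 1) z =
      (\<Sum>q=p2..p1. \<Sum>x\<le>p2. z 1 ^ (p1 + p2 - (q + x)) * schur [q, x] 1 z)"
    using assms by (subst schur_branching) (simp_all add: sum_strips_Cons sum_strips_singleton)
  also have "\<dots> = (\<Sum>q=p2..p1. z 1 ^ (p1 + p2 - q) * schur [q, 0] 1 z)"
    by (intro sum.cong refl, subst sum_atMost_eq_first) (auto simp: schur_too_many_rows)
  also have "\<dots> = (\<Sum>q=p2..p1. z 0 ^ q * z 1 ^ (p1 - q) * z 1 ^ p2)"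
  proof (intro sum.cong refl)
    fix q assume "q \<in> {p2..p1}"
    then have e: "p1 + p2 - q = (p1 - q) + p2" by simp
    show "z 1 ^ (p1 + p2 - q) * schur [q, 0] 1 z = z 0 ^ q * z 1 ^ (p1 - q) * z 1 ^ p2"
      using schur_append_0[of "[q]" 1 z] unfolding e by (simp add: schur_1[simplified] power_add algebra_simps)
  qed
  finally show ?thesis by (simp add: numeral_2_eq_2)
qed

lemma schur_3:
  assumes "p2 \<le> p1" "p3 \<le> p2"
  shows "schur [p1, p2, p3] 3 z =
    z 2 ^ p3 * (\<Sum>q=p2..p1. \<Sum>r=p3..p2. z 2 ^ (p1 - q) * z 2 ^ (p2 - r) * schur [q, r] 2 z)"
proof -
  have "schur [p1, p2, p3] (Suc 2) z =
      (\<Sum>q=p2..p1. \<Sum>r=p3..p2. \<Sum>x\<le>p3. z 2 ^ (p1 + (p2 + p3) - (q + (r + x))) * schur [q, r, x] 2 z)"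
    using assms by (subst schur_branching) (simp_all add: sum_strips_Cons sum_strips_singleton)
  also have "\<dots> = (\<Sum>q=p2..p1. \<Sum>r=p3..p2. z 2 ^ (p1 + (p2 + p3) - (q + (r + 0))) * schur [q, r, 0] 2 z)"
    by (intro sum.cong refl, subst sum_atMost_eq_first) (auto simp: schur_too_many_rows)
  also have "\<dots> = (\<Sum>q=p2..p1. \<Sum>r=p3..p2. z 2 ^ p3 * (z 2 ^ (p1 - q) * z 2 ^ (p2 - r) * schur [q, r] 2 z))"
  proof (intro sum.cong refl)
    fix q r assume "q \<in> {p2..p1}" "r \<in> {p3..p2}"
    then have e: "p1 + (p2 + p3) - (q + (r + 0)) = p3 + ((p1 - q) + (p2 - r))" by simp
    show "z 2 ^ (p1 + (p2 + p3) - (q + (r + 0))) * schur [q, r, 0] 2 z =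
        z 2 ^ p3 * (z 2 ^ (p1 - q) * z 2 ^ (p2 - r) * schur [q, r] 2 z)"
      using schur_append_0[of "[q, r]" 2 z] unfolding e by (simp add: power_add algebra_simps)
  qed
  finally show ?thesis by (simp add: sum_distrib_left eval_nat_numeral)
qed

lemma schur_4:
  assumes "p2 \<le> p1" "p3 \<le> p2" "p4 \<le> p3"
  shows "schur [p1, p2, p3, p4] 4 z =
    z 3 ^ p4 * (\<Sum>q=p2..p1. \<Sum>r=p3..p2. \<Sum>s=p4..p3.
      z 3 ^ (p1 - q) * z 3 ^ (p2 - r) * z 3 ^ (p3 - s) * schur [q, r, s] 3 z)"
proof -
  have "schur [p1, p2, p3, p4] (Suc 3) z =
      (\<Sum>q=p2..p1. \<Sum>r=p3..p2. \<Sum>s=p4..p3. \<Sum>x\<le>p4.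
        z 3 ^ (p1 + (p2 + (p3 + p4)) - (q + (r + (s + x)))) * schur [q, r, s, x] 3 z)"
    using assms by (subst schur_branching) (simp_all add: sum_strips_Cons sum_strips_singleton)
  also have "\<dots> = (\<Sum>q=p2..p1. \<Sum>r=p3..p2. \<Sum>s=p4..p3.
        z 3 ^ (p1 + (p2 + (p3 + p4)) - (q + (r + (s + 0)))) * schur [q, r, s, 0] 3 z)"
    by (intro sum.cong refl, subst sum_atMost_eq_first) (auto simp: schur_too_many_rows)
  also have "\<dots> = (\<Sum>q=p2..p1. \<Sum>r=p3..p2. \<Sum>s=p4..p3.
      z 3 ^ p4 * (z 3 ^ (p1 - q) * z 3 ^ (p2 - r) * z 3 ^ (p3 - s) * schur [q, r, s] 3 z))"
  proof (intro sum.cong refl)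
    fix q r s assume "q \<in> {p2..p1}" "r \<in> {p3..p2}" "s \<in> {p4..p3}"
    then have e: "p1 + (p2 + (p3 + p4)) - (q + (r + (s + 0))) = p4 + ((p1 - q) + (p2 - r) + (p3 - s))"
      by simp
    show "z 3 ^ (p1 + (p2 + (p3 + p4)) - (q + (r + (s + 0)))) * schur [q, r, s, 0] 3 z =
        z 3 ^ p4 * (z 3 ^ (p1 - q) * z 3 ^ (p2 - r) * z 3 ^ (p3 - s) * schur [q, r, s] 3 z)"
      using schur_append_0[of "[q, r, s]" 3 z] unfolding e by (simp add: power_add algebra_simps)
  qed
  finally show ?thesis by (simp add: sum_distrib_left eval_nat_numeral)
qed

section \<open>The bialternant formula\<close>

text \<open>For \<open>a \<le> b\<close> this is \<open>s ^ a\<close> times the complete homogeneous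
  polynomial of degree \<open>b - a\<close> in \<open>s\<close> and \<open>t\<close>.\<close>

definition geo :: "nat \<Rightarrow> nat \<Rightarrow> 'a::comm_ring_1 \<Rightarrow> 'a \<Rightarrow> 'a" where
  "geo a b s t = (\<Sum>q=a..b. s ^ q * t ^ (b - q))"

text \<open>Telescoping, kept in multiplied form because a commutative ring need not allow division
  by \<open>s - t\<close>.\<close>

lemma geo_mult:
  assumes "a \<le> b"
  shows "(s - t) * geo a b s t = s ^ Suc b - s ^ a * t ^ (Suc b - a)"
  using assms
proof (induction b rule: dec_induct)
  case base
  then show ?case by (simp add: geo_def algebra_simps)
next
  case (step b)
  have "geo a (Suc b) s t = t * geo a b s t + s ^ Suc b"
    using step.hyps by (simp add: geo_def sum_distrib_left Suc_diff_le mult_ac)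
  then have "(s - t) * geo a (Suc b) s t = t * ((s - t) * geo a b s t) + (s - t) * s ^ Suc b"
    by (simp only: algebra_simps)
  also have "\<dots> = s ^ Suc (Suc b) - s ^ a * t ^ Suc (Suc b - a)"
    unfolding step.IH by (simp add: algebra_simps)
  finally show ?case using step.hyps by (simp add: Suc_diff_le)
qed

definition det3 :: "'a::comm_ring_1 \<Rightarrow> 'a \<Rightarrow> 'a \<Rightarrow> 'a \<Rightarrow> 'a \<Rightarrow> 'a \<Rightarrow> 'a \<Rightarrow> 'a \<Rightarrow> 'a \<Rightarrow> 'a" where
  "det3 a1 b1 c1 a2 b2 c2 a3 b3 c3 =
    a1 * b2 * c3 - a1 * c2 * b3 - b1 * a2 * c3 + b1 * c2 * a3 + c1 * a2 * b3 - c1 * b2 * a3"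

definition alt3 :: "nat \<Rightarrow> nat \<Rightarrow> nat \<Rightarrow> 'a::comm_ring_1 \<Rightarrow> 'a \<Rightarrow> 'a \<Rightarrow> 'a" where
  "alt3 k l m a b c = det3 (a ^ k) (b ^ k) (c ^ k) (a ^ l) (b ^ l) (c ^ l) (a ^ m) (b ^ m) (c ^ m)"

text \<open>Laplace expansion, along the column of \<open>d\<close>, of the determinant with rows
  indexed by exponents and columns by variables.\<close>

definition alt4 :: "nat \<Rightarrow> nat \<Rightarrow> nat \<Rightarrow> nat \<Rightarrow> 'a::comm_ring_1 \<Rightarrow> 'a \<Rightarrow> 'a \<Rightarrow> 'a \<Rightarrow> 'a" where
  "alt4 k l m n a b c d =
    d ^ n * alt3 k l m a b c - d ^ m * alt3 k l n a b c + d ^ l * alt3 k m n a b c - d ^ k * alt3 l m n a b c"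

lemma schur_2_bialternant:
  assumes "p2 \<le> p1"
  shows "(z 0 - z 1) * schur [p1, p2] 2 z = z 0 ^ Suc p1 * z 1 ^ p2 - z 0 ^ p2 * z 1 ^ Suc p1"
proof -
  have "schur [p1, p2] 2 z = geo p2 p1 (z 0) (z 1) * z 1 ^ p2"
    by (simp add: schur_2[OF assms] geo_def sum_distrib_right)
  then have "(z 0 - z 1) * schur [p1, p2] 2 z = (z 0 - z 1) * geo p2 p1 (z 0) (z 1) * z 1 ^ p2"
    by simp
  also have "\<dots> = z 0 ^ Suc p1 * z 1 ^ p2 - z 0 ^ p2 * (z 1 ^ (Suc p1 - p2) * z 1 ^ p2)"
    unfolding geo_mult[OF assms] by (simp only: algebra_simps)
  also have "z 1 ^ (Suc p1 - p2) * z 1 ^ p2 = z 1 ^ Suc p1"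
    using assms by (simp flip: power_add del: power_Suc)
  finally show ?thesis .
qed

lemma schur_3_bialternant:
  assumes "p2 \<le> p1" "p3 \<le> p2"
  shows "(z 0 - z 1) * (z 0 - z 2) * (z 1 - z 2) * schur [p1, p2, p3] 3 z =
    alt3 (p1 + 2) (p2 + 1) p3 (z 0) (z 1) (z 2)"
proof -
  let ?a = "z 0" and ?b = "z 1" and ?c = "z 2"
  \<comment> \<open>\<open>w\<close>, \<open>v * w\<close> and \<open>u * v * w\<close> are the
    three powers of \<open>?c\<close> in the alternant, so \<open>u\<close> and \<open>v\<close> are
    the ratios of neighbouring rows in that column.\<close>
  define u where "u = ?c ^ (Suc p1 - p2)"
  define v where "v = ?c ^ (Suc p2 - p3)"
  define w where "w = ?c ^ p3"
  have vw: "?c ^ Suc p2 = v * w" unfolding v_def w_def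
    using assms by (simp flip: power_add del: power_Suc)
  have uvw: "?c ^ (p1 + 2) = u * v * w"
  proof -
    have "?c ^ (p1 + 2) = u * ?c ^ Suc p2" unfolding u_def
      using assms by (simp flip: power_add del: power_Suc)
    then show ?thesis by (simp only: vw mult.assoc)
  qed
  have "(?a - ?b) * schur [p1, p2, p3] 3 z =
      w * (\<Sum>q=p2..p1. \<Sum>r=p3..p2. ?c ^ (p1 - q) * ?c ^ (p2 - r) * ((?a - ?b) * schur [q, r] 2 z))"
    unfolding schur_3[OF assms] w_def by (simp add: sum_distrib_left mult_ac)
  also have "\<dots> = w * (\<Sum>q=p2..p1. \<Sum>r=p3..p2.
      ?a * (?a ^ q * ?c ^ (p1 - q)) * (?b ^ r * ?c ^ (p2 - r)) -
      ?b * (?b ^ q * ?c ^ (p1 - q)) * (?a ^ r * ?c ^ (p2 - r)))"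
    by (intro arg_cong[where f = "\<lambda>x. w * x"] sum.cong refl, subst schur_2_bialternant)
      (auto simp: algebra_simps)
  \<comment> \<open>The indices \<open>q\<close> and \<open>r\<close> are independent, so each
    double sum factors into two geometric sums.\<close>
  also have "\<dots> = w * (?a * geo p2 p1 ?a ?c * geo p3 p2 ?b ?c - ?b * geo p2 p1 ?b ?c * geo p3 p2 ?a ?c)"
    by (simp add: sum_subtractf geo_def sum_product sum_distrib_left mult_ac)
  finally have *: "(?a - ?b) * schur [p1, p2, p3] 3 z =
      w * (?a * geo p2 p1 ?a ?c * geo p3 p2 ?b ?c - ?b * geo p2 p1 ?b ?c * geo p3 p2 ?a ?c)" .
  have "(?a - ?b) * (?a - ?c) * (?b - ?c) * schur [p1, p2, p3] 3 z =
      (?a - ?c) * (?b - ?c) * ((?a - ?b) * schur [p1, p2, p3] 3 z)"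
    by (simp only: mult_ac)
  also have "\<dots> =
      w * (?a * ((?a - ?c) * geo p2 p1 ?a ?c) * ((?b - ?c) * geo p3 p2 ?b ?c) -
        ?b * ((?b - ?c) * geo p2 p1 ?b ?c) * ((?a - ?c) * geo p3 p2 ?a ?c))"
    unfolding * by (simp add: algebra_simps)
  also have "\<dots> = w * ((?a ^ (p1 + 2) - ?a ^ Suc p2 * u) * (?b ^ Suc p2 - ?b ^ p3 * v) -
        (?b ^ (p1 + 2) - ?b ^ Suc p2 * u) * (?a ^ Suc p2 - ?a ^ p3 * v))"
    unfolding geo_mult[OF assms(1)] geo_mult[OF assms(2)] u_def[symmetric] v_def[symmetric]
    by (simp add: algebra_simps)
  also have "\<dots> = alt3 (p1 + 2) (Suc p2) p3 ?a ?b ?c"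
    unfolding alt3_def det3_def vw uvw w_def[symmetric]
    by (simp add: algebra_simps del: power_Suc power_add_numeral)
  finally show ?thesis by simp
qed


lemma sum_prod3:
  fixes f g h :: "nat \<Rightarrow> 'a::comm_ring_1"
  shows "(\<Sum>q\<in>A. \<Sum>r\<in>B. \<Sum>s\<in>C. f q * g r * h s) = sum f A * sum g B * sum h C"
  by (simp only: sum_distrib_left[symmetric] sum_distrib_right[symmetric])

text \<open>Multilinearity in the rows: each summation index occurs in one row only.\<close>

lemma sum_det3:
  "(\<Sum>q\<in>A. \<Sum>r\<in>B. \<Sum>s\<in>C. det3 (f a q) (f b q) (f c q) (g a r) (g b r) (g c r) (h a s) (h b s) (h c s)) =
    det3 (sum (f a) A) (sum (f b) A) (sum (f c) A) (sum (g a) B) (sum (g b) B) (sum (g c) B)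
      (sum (h a) C) (sum (h b) C) (sum (h c) (C :: nat set))"
  for f g h :: "'a::comm_ring_1 \<Rightarrow> nat \<Rightarrow> 'a"
  unfolding det3_def by (simp only: sum_subtractf sum.distrib sum_prod3)

lemma det3_scale_columns:
  "x * y * z * det3 a1 b1 c1 a2 b2 c2 a3 b3 c3 =
    det3 (x * a1) (y * b1) (z * c1) (x * a2) (y * b2) (z * c2) (x * a3) (y * b3) (z * c3)"
  unfolding det3_def by (simp add: algebra_simps)

lemma det3_scale_rows:
  "det3 (x * a1) (x * b1) (x * c1) (y * a2) (y * b2) (y * c2) (z * a3) (z * b3) (z * c3) =
    x * y * z * det3 a1 b1 c1 a2 b2 c2 a3 b3 c3"
  unfolding det3_def by (simp add: algebra_simps)

text \<open>In the multilinear expansion every term with a repeated row vanishes. The four remaining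
  minors are those of the Laplace expansion in \<open>alt4\<close>, with \<open>t4\<close>,
  \<open>t3 * t4\<close> and so on as the powers of \<open>d\<close>.\<close>

lemma det3_row_differences:
  "t4 * det3 (a1 - a2 * t1) (b1 - b2 * t1) (c1 - c2 * t1) (a2 - a3 * t2) (b2 - b3 * t2) (c2 - c3 * t2)
      (a3 - a4 * t3) (b3 - b4 * t3) (c3 - c4 * t3) =
    t4 * det3 a1 b1 c1 a2 b2 c2 a3 b3 c3 - t3 * t4 * det3 a1 b1 c1 a2 b2 c2 a4 b4 c4 +
    t2 * t3 * t4 * det3 a1 b1 c1 a3 b3 c3 a4 b4 c4 - t1 * t2 * t3 * t4 * det3 a2 b2 c2 a3 b3 c3 a4 b4 c4"
  unfolding det3_def by (simp add: algebra_simps)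

definition vandermonde4 :: "(nat \<Rightarrow> 'a::comm_ring_1) \<Rightarrow> 'a" where
  "vandermonde4 z = (z 0 - z 1) * (z 0 - z 2) * (z 1 - z 2) * ((z 0 - z 3) * (z 1 - z 3) * (z 2 - z 3))"

lemma schur_4_bialternant:
  assumes "p2 \<le> p1" "p3 \<le> p2" "p4 \<le> p3"
  shows "vandermonde4 z * schur [p1, p2, p3, p4] 4 z =
    alt4 (p1 + 3) (p2 + 2) (p3 + 1) p4 (z 0) (z 1) (z 2) (z 3)"
proof -
  let ?a = "z 0" and ?b = "z 1" and ?c = "z 2" and ?d = "z 3"
  let ?V = "(?a - ?b) * (?a - ?c) * (?b - ?c)" and ?W = "(?a - ?d) * (?b - ?d) * (?c - ?d)"
  let ?S = "schur [p1, p2, p3, p4] 4 z"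
  define t1 where "t1 = ?d ^ (Suc p1 - p2)"
  define t2 where "t2 = ?d ^ (Suc p2 - p3)"
  define t3 where "t3 = ?d ^ (Suc p3 - p4)"
  define t4 where "t4 = ?d ^ p4"
  have e3: "?d ^ (p3 + 1) = t3 * t4" unfolding t3_def t4_def
    using assms by (simp flip: power_add del: power_Suc)
  have "?d ^ (p2 + 2) = t2 * ?d ^ (p3 + 1)" unfolding t2_def
    using assms by (simp flip: power_add del: power_Suc)
  then have e2: "?d ^ (p2 + 2) = t2 * t3 * t4" by (simp only: e3 mult.assoc)
  have "?d ^ (p1 + 3) = t1 * ?d ^ (p2 + 2)" unfolding t1_def
    using assms by (simp flip: power_add del: power_Suc add: eval_nat_numeral)
  then have e1: "?d ^ (p1 + 3) = t1 * t2 * t3 * t4" by (simp only: e2 mult.assoc)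
  \<comment> \<open>\<open>f\<close>, \<open>g\<close> and \<open>h\<close> give the rows of
    \<open>alt3 (q + 2) (r + 1) s\<close>, each with its own power of \<open>?d\<close> absorbed;
    \<open>x ^ 2\<close> and \<open>x\<close> are the staircase shifts.\<close>
  define f where "f x q = x ^ 2 * (x ^ q * ?d ^ (p1 - q))" for x q
  define g where "g x q = x * (x ^ q * ?d ^ (p2 - q))" for x q
  define h where "h x q = x ^ q * ?d ^ (p3 - q)" for x q
  have F: "(x - ?d) * sum (f x) {p2..p1} = x ^ (p1 + 3) - x ^ (p2 + 2) * t1" for x
  proof -
    have "(x - ?d) * sum (f x) {p2..p1} = x ^ 2 * ((x - ?d) * geo p2 p1 x ?d)"
      by (simp only: f_def geo_def sum_distrib_left mult_ac)
    then show ?thesis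
      unfolding geo_mult[OF assms(1)] t1_def by (simp add: algebra_simps eval_nat_numeral)
  qed
  have G: "(x - ?d) * sum (g x) {p3..p2} = x ^ (p2 + 2) - x ^ (p3 + 1) * t2" for x
  proof -
    have "(x - ?d) * sum (g x) {p3..p2} = x * ((x - ?d) * geo p3 p2 x ?d)"
      by (simp only: g_def geo_def sum_distrib_left mult_ac)
    then show ?thesis
      unfolding geo_mult[OF assms(2)] t2_def by (simp add: algebra_simps eval_nat_numeral)
  qed
  have H: "(x - ?d) * sum (h x) {p4..p3} = x ^ (p3 + 1) - x ^ p4 * t3" for x
    using geo_mult[OF assms(3), of x ?d] by (simp add: h_def[abs_def] geo_def t3_def)
  have "?V * ?S = t4 * (\<Sum>q=p2..p1. \<Sum>r=p3..p2. \<Sum>s=p4..p3.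
      ?d ^ (p1 - q) * ?d ^ (p2 - r) * ?d ^ (p3 - s) * (?V * schur [q, r, s] 3 z))"
    unfolding schur_4[OF assms] t4_def by (simp only: sum_distrib_left mult_ac)
  also have "\<dots> = t4 * (\<Sum>q=p2..p1. \<Sum>r=p3..p2. \<Sum>s=p4..p3.
      det3 (f ?a q) (f ?b q) (f ?c q) (g ?a r) (g ?b r) (g ?c r) (h ?a s) (h ?b s) (h ?c s))"
  proof (intro arg_cong[where f = "\<lambda>x. t4 * x"] sum.cong refl)
    fix q r s assume "q \<in> {p2..p1}" "r \<in> {p3..p2}" "s \<in> {p4..p3}"
    then have V: "?V * schur [q, r, s] 3 z = alt3 (q + 2) (r + 1) s ?a ?b ?c"
      by (intro schur_3_bialternant) auto
    show "?d ^ (p1 - q) * ?d ^ (p2 - r) * ?d ^ (p3 - s) * (?V * schur [q, r, s] 3 z) =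
        det3 (f ?a q) (f ?b q) (f ?c q) (g ?a r) (g ?b r) (g ?c r) (h ?a s) (h ?b s) (h ?c s)"
      unfolding V alt3_def det3_scale_rows[symmetric] f_def g_def h_def
      by (simp only: power_add power_one_right mult_ac)
  qed
  finally have V: "?V * ?S = t4 * det3
      (sum (f ?a) {p2..p1}) (sum (f ?b) {p2..p1}) (sum (f ?c) {p2..p1})
      (sum (g ?a) {p3..p2}) (sum (g ?b) {p3..p2}) (sum (g ?c) {p3..p2})
      (sum (h ?a) {p4..p3}) (sum (h ?b) {p4..p3}) (sum (h ?c) {p4..p3})" (is "_ = t4 * ?D")
    by (simp only: sum_det3)
  have "vandermonde4 z * ?S = ?W * (?V * ?S)"
    unfolding vandermonde4_def by (simp only: mult_ac)
  \<comment> \<open>Each factor of \<open>?W\<close> is now moved into one column, where it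
    telescopes the geometric sums into row differences.\<close>
  also have "\<dots> = t4 * (?W * ?D)"
    unfolding V by (rule mult.left_commute)
  also have "\<dots> = alt4 (p1 + 3) (p2 + 2) (p3 + 1) p4 ?a ?b ?c ?d"
    unfolding det3_scale_columns F G H det3_row_differences alt4_def alt3_def e1 e2 e3 t4_def[symmetric] ..
  finally show ?thesis .
qed


section \<open>Double power series\<close>

text \<open>\<open>U\<close> is the outer and \<open>X\<close> the inner variable. Nested series
  over the integers form an integral domain, so the Vandermonde product can be cancelled.\<close>

definition U :: "int fps fps" where "U = fps_X"

definition X :: "int fps fps" where "X = fps_const fps_X"

text \<open>Integer indices with value zero at negative ones make multiplication by \<open>U\<close>
  or \<open>X\<close> a pure index shift.\<close>

definition cf :: "int fps fps \<Rightarrow> int \<Rightarrow> int \<Rightarrow> int" where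
  "cf f n m = (if n < 0 \<or> m < 0 then 0 else fps_nth (fps_nth f (nat n)) (nat m))"

lemma cf_add: "cf (f + g) n m = cf f n m + cf g n m"
  by (simp add: cf_def)

lemma cf_diff: "cf (f - g) n m = cf f n m - cf g n m"
  by (simp add: cf_def)

lemma cf_uminus: "cf (- f) n m = - cf f n m"
  by (simp add: cf_def)

lemma cf_sum: "cf (sum f A) n m = (\<Sum>x\<in>A. cf (f x) n m)"
  by (simp add: cf_def fps_sum_nth)

lemma cf_one: "cf 1 n m = of_bool (n = 0 \<and> m = 0)"
  by (auto simp: cf_def)

lemma cf_U: "cf (U * f) n m = cf f (n - 1) m"
  by (auto simp: cf_def U_def nat_diff_distrib)

lemma cf_X: "cf (X * f) n m = cf f n (m - 1)"
  by (auto simp: cf_def X_def nat_diff_distrib)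

lemma cf_ext: "(\<And>n m. cf f n m = cf g n m) \<Longrightarrow> f = g"
proof (rule fps_ext, rule fps_ext)
  fix n m assume "\<And>n m. cf f n m = cf g n m"
  from this[of "int n" "int m"] show "fps_nth (fps_nth f n) m = fps_nth (fps_nth g n) m"
    by (simp add: cf_def)
qed

lemma cf_U_power: "cf (U ^ k * f) n m = cf f (n - int k) m"
  by (induction k arbitrary: n) (simp_all add: cf_U algebra_simps)

lemma cf_X_power: "cf (X ^ k * f) n m = cf f n (m - int k)"
  by (induction k arbitrary: m) (simp_all add: cf_X algebra_simps)

lemma cf_monomial:
  "cf ((U * X) ^ i * X ^ j * (X * (U * X)) ^ k * f) n m =
    cf f (n - int i - int k) (m - int i - int j - 2 * int k)"
proof -
  have eq: "(U * X) ^ i * X ^ j * (X * (U * X)) ^ k * f =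
      U ^ i * (U ^ k * (X ^ i * (X ^ j * (X ^ k * (X ^ k * f)))))"
    by (simp only: power_mult_distrib mult_ac)
  have "m - int i - int j - int k - int k = m - int i - int j - 2 * int k" by simp
  then show ?thesis unfolding eq by (simp only: cf_U_power cf_X_power)
qed

section \<open>The generating function of pS\<close>

lemma pS_eq: "pS n m = card {(x1, x2, x3, x4).
    int (x1::nat) + int (x3::nat) + int (x4::nat) = n \<and> int (x2::nat) + int x3 + 2 * int x4 = m}"
    (is "_ = card ?A")
proof (cases "n < 0 \<or> m < 0")
  case True
  then have "?A = {}" by auto
  with True show ?thesis by (simp only: pS_def if_True card.empty)
qed (simp add: pS_def)

lemma finite_pS: "finite {(x1, x2, x3, x4).
    int (x1::nat) + int (x3::nat) + int (x4::nat) = n \<and> int (x2::nat) + int x3 + 2 * int x4 = m}"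
  by (rule finite_subset[of _ "{..nat n} \<times> {..nat m} \<times> {..nat n} \<times> {..nat n}"]) auto

definition pS3 :: "int \<Rightarrow> int \<Rightarrow> nat" where
  "pS3 n m = card {(x2, x3, x4).
    int (x3::nat) + int (x4::nat) = n \<and> int (x2::nat) + int x3 + 2 * int x4 = m}"

lemma finite_pS3: "finite {(x2, x3, x4).
    int (x3::nat) + int (x4::nat) = n \<and> int (x2::nat) + int x3 + 2 * int x4 = m}"
  by (rule finite_subset[of _ "{..nat m} \<times> {..nat n} \<times> {..nat n}"]) auto

lemma card_eq_add_images:
  assumes "A = f ` B \<union> g ` C" "f ` B \<inter> g ` C = {}" "inj f" "inj g" "finite B" "finite C"
  shows "card A = card B + card C"
  using assms card_Un_disjoint[of "f ` B" "g ` C"]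
  by (simp add: card_image inj_on_subset)

lemma pS_rec: "pS n m = pS (n - 1) m + pS3 n m"
proof -
  let ?A = "\<lambda>n. {(x1, x2, x3, x4).
    int (x1::nat) + int (x3::nat) + int (x4::nat) = n \<and> int (x2::nat) + int x3 + 2 * int x4 = m}"
  let ?B = "{(x2, x3, x4).
    int (x3::nat) + int (x4::nat) = n \<and> int (x2::nat) + int x3 + 2 * int x4 = m}"
  let ?f = "\<lambda>(x1, x2, x3, x4). (Suc x1, x2 :: nat, x3 :: nat, x4 :: nat)"
  let ?g = "\<lambda>(x2, x3, x4). (0 :: nat, x2 :: nat, x3 :: nat, x4 :: nat)"
  have "?A n = ?f ` ?A (n - 1) \<union> ?g ` ?B"
  proof (intro equalityI subsetI)
    fix x assume "x \<in> ?A n"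
    then obtain x1 x2 x3 x4 where x: "x = (x1, x2, x3, x4)" "(x1, x2, x3, x4) \<in> ?A n"
      by (cases x) auto
    show "x \<in> ?f ` ?A (n - 1) \<union> ?g ` ?B"
    proof (cases x1)
      case 0
      then have "x = ?g (x2, x3, x4)" "(x2, x3, x4) \<in> ?B" using x by auto
      then show ?thesis by blast
    next
      case (Suc y)
      then have "x = ?f (y, x2, x3, x4)" "(y, x2, x3, x4) \<in> ?A (n - 1)" using x by auto
      then show ?thesis by blast
    qed
  qed auto
  then have "card (?A n) = card (?A (n - 1)) + card ?B"
    by (rule card_eq_add_images) (use finite_pS finite_pS3 in \<open>auto simp: inj_def\<close>)
  then show ?thesis by (simp add: pS_eq pS3_def)
qed

lemma pS3_rec: "pS3 n m = pS3 n (m - 1) + of_bool (n \<le> m \<and> m \<le> 2 * n)"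
proof -
  let ?A = "\<lambda>m. {(x2, x3, x4).
    int (x3::nat) + int (x4::nat) = n \<and> int (x2::nat) + int x3 + 2 * int x4 = m}"
  let ?B = "{(x3, x4). int (x3::nat) + int (x4::nat) = n \<and> int x3 + 2 * int x4 = m}"
  let ?f = "\<lambda>(x2, x3, x4). (Suc x2, x3 :: nat, x4 :: nat)"
  let ?g = "\<lambda>(x3, x4). (0 :: nat, x3 :: nat, x4 :: nat)"
  have "?A m = ?f ` ?A (m - 1) \<union> ?g ` ?B"
  proof (intro equalityI subsetI)
    fix x assume "x \<in> ?A m"
    then obtain x2 x3 x4 where x: "x = (x2, x3, x4)" "(x2, x3, x4) \<in> ?A m"
      by (cases x) auto
    show "x \<in> ?f ` ?A (m - 1) \<union> ?g ` ?B"
    proof (cases x2)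
      case 0
      then have "x = ?g (x3, x4)" "(x3, x4) \<in> ?B" using x by auto
      then show ?thesis by blast
    next
      case (Suc y)
      then have "x = ?f (y, x3, x4)" "(y, x3, x4) \<in> ?A (m - 1)" using x by auto
      then show ?thesis by blast
    qed
  qed auto
  \<comment> \<open>Two linear equations in \<open>x3\<close> and \<open>x4\<close> have one integer
    solution, which is nonnegative exactly in this range.\<close>
  moreover have B: "?B = (if n \<le> m \<and> m \<le> 2 * n then {(nat (2 * n - m), nat (m - n))} else {})"
    by auto
  then have "finite ?B" by simp
  ultimately have "card (?A m) = card (?A (m - 1)) + card ?B"
    by (intro card_eq_add_images) (use finite_pS3 in \<open>auto simp: inj_def\<close>)
  also have "card ?B = of_bool (n \<le> m \<and> m \<le> 2 * n)"
    unfolding B by simp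
  finally show ?thesis by (simp add: pS3_def)
qed

definition pS_gf :: "int fps fps" where
  "pS_gf = Abs_fps (\<lambda>n. Abs_fps (\<lambda>m. int (pS (int n) (int m))))"

lemma cf_pS_gf: "cf pS_gf n m = int (pS n m)"
  by (auto simp: cf_def pS_gf_def pS_def)

definition pS_den :: "int fps fps" where
  "pS_den = (1 - U) * (1 - X) * (1 - U * X) * (1 - X * (U * X))"

text \<open>The factors are applied one at a time: \<open>1 - U\<close> forces
  \<open>x1 = 0\<close>, \<open>1 - X\<close> forces \<open>x2 = 0\<close>, \<open>1 - U * X\<close>
  leaves the ray \<open>m = 2 * n\<close>, and the last factor leaves the origin.\<close>

lemma pS_den_gf: "pS_den * pS_gf = 1"
proof -
  define Q1 where "Q1 = pS_gf - U * pS_gf"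
  define Q2 where "Q2 = Q1 - X * Q1"
  define Q3 where "Q3 = Q2 - U * (X * Q2)"
  define Q4 where "Q4 = Q3 - X * (U * (X * Q3))"
  have 1: "cf Q1 n m = int (pS3 n m)" for n m
    using pS_rec[of n m] by (simp add: Q1_def cf_diff cf_U cf_pS_gf)
  have 2: "cf Q2 n m = of_bool (n \<le> m \<and> m \<le> 2 * n)" for n m
    using pS3_rec[of n m] by (simp add: Q2_def cf_diff cf_X 1)
  have 3: "cf Q3 n m = of_bool (0 \<le> n \<and> m = 2 * n)" for n m
    by (auto simp: Q3_def cf_diff cf_X cf_U 2)
  have "cf Q4 n m = cf 1 n m" for n m
    by (auto simp: Q4_def cf_diff cf_X cf_U cf_one 3)
  then have "Q4 = 1" by (rule cf_ext)
  moreover have "pS_den * pS_gf = Q4"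
    by (simp add: pS_den_def Q4_def Q3_def Q2_def Q1_def algebra_simps)
  ultimately show ?thesis by simp
qed

text \<open>Since \<open>x3 + 2 * x4 \<le> 2 * n\<close>, the variable \<open>x2\<close> is slack of
  size at least \<open>m - 2 * n\<close>, and shifting it is a bijection.\<close>

lemma pS_stable:
  assumes "2 * n \<le> m" "2 * n \<le> m'"
  shows "pS n m = pS n m'"
proof -
  have *: "pS n m = pS n (2 * n)" if "2 * n \<le> m" for m
    unfolding pS_eq
  proof (rule bij_betw_same_card[OF bij_betw_byWitness[where
        f = "\<lambda>(x1, x2, x3, x4). (x1, x2 - nat (m - 2 * n), x3, x4)" and
        f' = "\<lambda>(x1, x2, x3, x4). (x1, x2 + nat (m - 2 * n), x3, x4)"]])
  qed (use that in auto)
  show ?thesis using *[OF assms(1)] *[OF assms(2)] by simp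
qed

text \<open>With \<open>x = X\<close> and \<open>y = U * X\<close> the monomials y/x, xy, x, y
  become \<open>U\<close>, \<open>U * X ^ 2\<close>, \<open>X\<close>, \<open>U * X\<close>, the
  factors of \<open>pS_den\<close>; the exponents (i, j) become \<open>j\<close> for
  \<open>U\<close> and \<open>i + j\<close> for \<open>X\<close>.\<close>

lemma Fbar_coeff_eq: "Fbar_coeff i j = pS j (i + j)"
  unfolding Fbar_coeff_def pS_eq
  by (rule bij_betw_same_card[OF bij_betw_byWitness[where
        f = "\<lambda>(k1, k2, k3, k4). (k1, k3, k4, k2)" and f' = "\<lambda>(x1, x2, x3, x4). (x1, x4, x2, x3)"]])
    auto

lemma pS_nonzero_iff: "pS n m \<noteq> 0 \<longleftrightarrow> 0 \<le> n \<and> 0 \<le> m"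
proof (cases "0 \<le> n \<and> 0 \<le> m")
  case True
  let ?A = "{(x1, x2, x3, x4).
    int (x1::nat) + int (x3::nat) + int (x4::nat) = n \<and> int (x2::nat) + int x3 + 2 * int x4 = m}"
  \<comment> \<open>\<open>x1\<close> and \<open>x2\<close> each occur in only one equation, so they
    alone can meet both.\<close>
  have "(nat n, nat m, 0, 0) \<in> ?A" using True by auto
  then have "?A \<noteq> {}" by (metis empty_iff)
  then have "card ?A \<noteq> 0" by (simp only: card_0_eq[OF finite_pS] not_False_eq_True)
  then show ?thesis using True by (simp only: pS_eq simp_thms)
qed (auto simp: pS_def)

section \<open>Specialisation of the bialternant formula\<close>

text \<open>The 24 terms in the fixed order \<open>b\<close>, \<open>c\<close>, \<open>d\<close>,
  which is the shape \<open>cf_monomial\<close> evaluates at \<open>U * X\<close>, \<open>X\<close>,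
  \<open>X * (U * X)\<close>.\<close>

lemma alt4_one_mult:
  fixes b c d f :: "'a::comm_ring_1"
  shows "alt4 k l m n 1 b c d * f =
    b ^ l * c ^ m * d ^ n * f - b ^ l * c ^ n * d ^ m * f - b ^ m * c ^ l * d ^ n * f + b ^ n * c ^ l * d ^ m * f
    + b ^ m * c ^ n * d ^ l * f - b ^ n * c ^ m * d ^ l * f - b ^ k * c ^ m * d ^ n * f + b ^ k * c ^ n * d ^ m * f
    + b ^ k * c ^ l * d ^ n * f - b ^ k * c ^ l * d ^ m * f - b ^ k * c ^ n * d ^ l * f + b ^ k * c ^ m * d ^ l * f
    + b ^ m * c ^ k * d ^ n * f - b ^ n * c ^ k * d ^ m * f - b ^ l * c ^ k * d ^ n * f + b ^ l * c ^ k * d ^ m * f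
    + b ^ n * c ^ k * d ^ l * f - b ^ m * c ^ k * d ^ l * f - b ^ m * c ^ n * d ^ k * f + b ^ n * c ^ m * d ^ k * f
    + b ^ l * c ^ n * d ^ k * f - b ^ l * c ^ m * d ^ k * f - b ^ n * c ^ l * d ^ k * f + b ^ m * c ^ l * d ^ k * f"
  unfolding alt4_def alt3_def det3_def by (simp only: power_one mult_1_left algebra_simps)

text \<open>These double transpositions of columns are what exchanging the two x's, respectively the
  two y's, does to the four letters.\<close>

lemma alt4_even_permutations:
  "alt4 k l m n c d a b = alt4 k l m n a b c d"
  "alt4 k l m n b a d c = alt4 k l m n a b c d"
  unfolding alt4_def alt3_def det3_def by (simp_all only: algebra_simps)

text \<open>Four, respectively two, differences are reversed, so the signs cancel.\<close>

lemma vandermonde4_even_permutations: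
  "(c - d) * (c - a) * (d - a) * ((c - b) * (d - b) * (a - b)) =
    (a - b) * (a - c) * (b - c) * ((a - d) * (b - d) * (c - (d :: 'a::comm_ring_1)))"
  "(b - a) * (b - d) * (a - d) * ((b - c) * (a - c) * (d - c)) =
    (a - b) * (a - c) * (b - c) * ((a - d) * (b - d) * (c - (d :: 'a::comm_ring_1)))"
  by (simp_all only: minus_diff_eq[of a c, symmetric] minus_diff_eq[of a d, symmetric]
      minus_diff_eq[of b c, symmetric] minus_diff_eq[of b d, symmetric]
      minus_diff_eq[of a b, symmetric] minus_diff_eq[of c d, symmetric]
      mult_minus_left mult_minus_right minus_minus mult_ac)


lemma all_less_2: "(\<forall>i<2. P i) \<longleftrightarrow> P 0 \<and> P (1::nat)"
  by (auto simp: less_2_cases_iff)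

lemma prod_if_const:
  assumes "finite C"
  shows "(\<Prod>c\<in>C. if P c then u else v) =
    u ^ card {c \<in> C. P c} * (v :: 'a::comm_ring_1) ^ (card C - card {c \<in> C. P c})"
proof -
  have "C \<inter> - {c. P c} = C - {c \<in> C. P c}" "C \<inter> {c. P c} = {c \<in> C. P c}" by auto
  moreover have "card (C - {c \<in> C. P c}) = card C - card {c \<in> C. P c}"
    using assms by (intro card_Diff_subset) auto
  ultimately show ?thesis using assms by (simp add: prod.If_cases)
qed

text \<open>The letter \<open>k\<close> stands for \<open>x\<^sub>i y\<^sub>j\<close> with \<open>i = k div 2\<close> and \<open>j = k mod 2\<close>;
  \<open>xdeg\<close> and \<open>ydeg\<close> are the exponents of \<open>x\<^sub>1\<close> and \<open>y\<^sub>1\<close>.\<close>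

definition xdeg :: "nat list \<Rightarrow> (nat \<Rightarrow> nat \<Rightarrow> nat) \<Rightarrow> nat" where
  "xdeg p T = card {c \<in> cells p. T (fst c) (snd c) div 2 = 1}"

definition ydeg :: "nat list \<Rightarrow> (nat \<Rightarrow> nat \<Rightarrow> nat) \<Rightarrow> nat" where
  "ydeg p T = card {c \<in> cells p. T (fst c) (snd c) mod 2 = 1}"

definition letter :: "'a::comm_ring_1 \<Rightarrow> 'a \<Rightarrow> 'a \<Rightarrow> 'a \<Rightarrow> nat \<Rightarrow> 'a" where
  "letter x0 x1 y0 y1 k = (if k div 2 = 1 then x1 else x0) * (if k mod 2 = 1 then y1 else y0)"

lemma tab_weight_letter:
  "tab_weight p (letter x0 x1 y0 y1) T =
    (x1 ^ xdeg p T * x0 ^ (sum_list p - xdeg p T)) * (y1 ^ ydeg p T * y0 ^ (sum_list p - ydeg p T))"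
  unfolding tab_weight_def letter_def prod.distrib
  by (simp only: prod_if_const[OF finite_cells] xdeg_def ydeg_def card_cells)

lemma xdeg_le: "xdeg p T \<le> sum_list p"
  unfolding xdeg_def card_cells[symmetric] by (rule card_mono) auto

lemma ydeg_le: "ydeg p T \<le> sum_list p"
  unfolding ydeg_def card_cells[symmetric] by (rule card_mono) auto

text \<open>Integer arguments give zero boundary values at -1 when differences are taken.\<close>

definition tab_count :: "nat list \<Rightarrow> int \<Rightarrow> int \<Rightarrow> int" where
  "tab_count p i j = int (card {T \<in> ssyt p 4. int (xdeg p T) = i \<and> int (ydeg p T) = j})"

lemma cf_sum_monomials:
  assumes "finite A"
  shows "cf (\<Sum>T\<in>A. X ^ f T * (U * X) ^ g T) n m =
    int (card {T \<in> A. int (f T) = m - n \<and> int (g T) = n})"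
proof -
  have "cf (X ^ a * (U * X) ^ b) n m = of_bool (int a = m - n \<and> int b = n)" for a b
    using cf_monomial[of b a 0 1 n m] by (auto simp: cf_one mult.commute)
  then have "cf (\<Sum>T\<in>A. X ^ f T * (U * X) ^ g T) n m =
      (\<Sum>T\<in>A. of_bool (int (f T) = m - n \<and> int (g T) = n))"
    by (simp add: cf_sum)
  then show ?thesis using assms by (simp add: of_bool_def sum.inter_filter[symmetric])
qed

lemma cf_schur:
  "cf (schur p 4 (letter 1 X 1 (U * X))) n m = tab_count p (m - n) n"
  unfolding schur_def tab_weight_letter power_one mult_1_right tab_count_def
  by (rule cf_sum_monomials[OF finite_ssyt])

lemma cf_schur_swap_x:
  "cf (schur p 4 (letter X 1 1 (U * X))) n m = tab_count p (int (sum_list p) - (m - n)) n"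
proof -
  have "int (sum_list p - xdeg p T) = k \<longleftrightarrow> int (xdeg p T) = int (sum_list p) - k" for T k
    using xdeg_le[of p T] by auto
  then show ?thesis
    unfolding schur_def tab_weight_letter power_one mult_1_right mult_1_left tab_count_def
    by (subst cf_sum_monomials[OF finite_ssyt]) simp
qed

lemma cf_schur_swap_y:
  "cf (schur p 4 (letter 1 X (U * X) 1)) n m = tab_count p (m - n) (int (sum_list p) - n)"
proof -
  have "int (sum_list p - ydeg p T) = k \<longleftrightarrow> int (ydeg p T) = int (sum_list p) - k" for T k
    using ydeg_le[of p T] by auto
  then show ?thesis
    unfolding schur_def tab_weight_letter power_one mult_1_right mult_1_left tab_count_def
    by (subst cf_sum_monomials[OF finite_ssyt]) simp
qed

text \<open>Among the six differences of letters, \<open>1 - X\<close> and \<open>1 - U * X\<close>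
  each occur twice: one copy belongs to \<open>pS_den\<close>, the other acts as a difference
  operator on coefficients.\<close>

lemma vandermonde4_letter:
  "vandermonde4 (letter 1 X 1 (U * X)) = - (U * X ^ 3 * ((1 - X) * (1 - U * X)) * pS_den)"
proof -
  have e: "X - X * (U * X) = X * (1 - U * X)"
      "U * X - X * (U * X) = U * X * (1 - X)" "U * X - X = - (X * (1 - U))"
    by (simp_all add: algebra_simps)
  have "vandermonde4 (letter 1 X 1 (U * X)) =
      (1 - U * X) * (1 - X) * (U * X - X) * ((1 - X * (U * X)) * (U * X - X * (U * X)) * (X - X * (U * X)))"
    by (simp add: vandermonde4_def letter_def)
  also have "\<dots> = - (U * X ^ 3 * ((1 - X) * (1 - U * X)) * pS_den)"
    unfolding e pS_den_def power3_eq_cube mult_minus_left mult_minus_right by (simp only: mult_ac)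
  finally show ?thesis .
qed

lemma pS_den_nonzero: "pS_den \<noteq> 0"
  using pS_den_gf by auto

lemma vandermonde4_letter_nonzero: "vandermonde4 (letter 1 X 1 (U * X)) \<noteq> 0"
proof -
  have "U \<noteq> 0" "X \<noteq> 0" by (simp_all add: U_def X_def)
  moreover have "1 - X \<noteq> 0" "1 - U * X \<noteq> 0" using pS_den_nonzero unfolding pS_den_def by auto
  ultimately show ?thesis using pS_den_nonzero unfolding vandermonde4_letter by simp
qed

section \<open>Symmetry of the weight counts and their mixed differences\<close>

locale four_row_partition =
  fixes l1 l2 l3 l4 :: nat
  assumes l_ge: "l2 \<le> l1" "l3 \<le> l2" "l4 \<le> l3"
begin

abbreviation "lam \<equiv> [l1, l2, l3, l4]"

abbreviation "d \<equiv> l1 + l2 + l3 + l4"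

abbreviation "N \<equiv> tab_count lam"

text \<open>Permuting the letters evenly changes neither the alternant nor the Vandermonde product.
  Cancelling the latter makes the two Schur polynomials equal, and the swapped one counts
  complementary x-degrees.\<close>

lemma N_symmetric_x: "N (int d - i) j = N i j"
proof -
  let ?z = "letter 1 X 1 (U * X)" and ?z' = "letter X 1 1 (U * X)"
  have z': "?z' 0 = ?z 2" "?z' 1 = ?z 3" "?z' 2 = ?z 0" "?z' 3 = ?z 1"
    by (simp_all add: letter_def)
  have "vandermonde4 ?z * schur lam 4 ?z' = vandermonde4 ?z' * schur lam 4 ?z'"
    unfolding vandermonde4_def z' by (simp only: vandermonde4_even_permutations(1))
  also have "\<dots> = vandermonde4 ?z * schur lam 4 ?z"
    unfolding schur_4_bialternant[OF l_ge] z' by (rule alt4_even_permutations(1))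
  finally have "schur lam 4 ?z' = schur lam 4 ?z"
    using vandermonde4_letter_nonzero by simp
  then show ?thesis
    using cf_schur[of lam j "i + j"] cf_schur_swap_x[of lam j "i + j"] by (simp add: add.assoc)
qed

lemma N_symmetric_y: "N i (int d - j) = N i j"
proof -
  let ?z = "letter 1 X 1 (U * X)" and ?z' = "letter 1 X (U * X) 1"
  have z': "?z' 0 = ?z 1" "?z' 1 = ?z 0" "?z' 2 = ?z 3" "?z' 3 = ?z 2"
    by (simp_all add: letter_def)
  have "vandermonde4 ?z * schur lam 4 ?z' = vandermonde4 ?z' * schur lam 4 ?z'"
    unfolding vandermonde4_def z' by (simp only: vandermonde4_even_permutations(2))
  also have "\<dots> = vandermonde4 ?z * schur lam 4 ?z"
    unfolding schur_4_bialternant[OF l_ge] z' by (rule alt4_even_permutations(2))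
  finally have "schur lam 4 ?z' = schur lam 4 ?z"
    using vandermonde4_letter_nonzero by simp
  then show ?thesis
    using cf_schur[of lam j "i + j"] cf_schur_swap_y[of lam j "i + j"] by (simp add: add.assoc)
qed

definition g :: "int \<Rightarrow> int \<Rightarrow> int" where
  "g i j = N i j - N (i - 1) j - (N i (j - 1) - N (i - 1) (j - 1))"

text \<open>Multiplying the bialternant formula by \<open>pS_gf\<close> cancels
  \<open>pS_den\<close>. The leftover factor \<open>- U * X ^ 3\<close> accounts for the sign and
  for the shift from position (j, i + j).\<close>

lemma g_eq_cf_alt4:
  "g i j = - cf (alt4 (l1 + 3) (l2 + 2) (l3 + 1) l4 1 (U * X) X (X * (U * X)) * pS_gf) (j + 1) (i + j + 3)"
proof -
  let ?z = "letter 1 X 1 (U * X)"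
  let ?S = "schur lam 4 ?z"
  define G where "G = (1 - X) * (1 - U * X) * ?S"
  have z: "?z 0 = 1" "?z 1 = U * X" "?z 2 = X" "?z 3 = X * (U * X)"
    by (simp_all add: letter_def)
  have "alt4 (l1 + 3) (l2 + 2) (l3 + 1) l4 1 (U * X) X (X * (U * X)) * pS_gf =
      vandermonde4 ?z * ?S * pS_gf"
    using schur_4_bialternant[OF l_ge, of ?z] unfolding z by simp
  also have "\<dots> = - (U * (X ^ 3 * (G * (pS_den * pS_gf))))"
    unfolding vandermonde4_letter G_def mult_minus_left by (simp only: mult_ac)
  also have "\<dots> = - (U * (X ^ 3 * G))" by (simp add: pS_den_gf)
  finally have "cf (alt4 (l1 + 3) (l2 + 2) (l3 + 1) l4 1 (U * X) X (X * (U * X)) * pS_gf) (j + 1) (i + j + 3)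
      = - cf G j (i + j)"
    by (simp add: cf_uminus cf_U cf_X_power)
  moreover have "G = ?S - X * ?S - U * (X * ?S) + U * (X * (X * ?S))"
    by (simp add: G_def algebra_simps)
  ultimately show ?thesis
    by (simp add: cf_add cf_diff cf_U cf_X cf_schur g_def algebra_simps)
qed

lemma g_eq_pS:
  assumes "j \<le> i" "2 * i \<le> int d"
  shows "g i j =
          int (pS (j - (int l3 + int l4)) (j - (int l3 + int l4) + i - (int l2 + int l4)))
        - int (pS (j - (int l3 + int l4)) (j - (int l3 + int l4) + i - (int l2 + int l3 + 1)))
        - int (pS (j - (int l3 + int l4)) (j - (int l3 + int l4) + i - (int l1 + int l4 + 1)))
        + int (pS (j - (int l3 + int l4)) (j - (int l3 + int l4) + i - (int l1 + int l3 + 2)))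
        - int (pS (j - (int l2 + int l4 + 1)) (j - (int l2 + int l4 + 1) + i - (int l3 + int l4 - 1)))
        + int (pS (j - (int l2 + int l4 + 1)) (j - (int l2 + int l4 + 1) + i - (int l2 + int l3 + 1)))
        + int (pS (j - (int l2 + int l4 + 1)) (j - (int l2 + int l4 + 1) + i - (int l1 + int l4 + 1)))"
proof -
  \<comment> \<open>The contribution of one alternant term, with \<open>p\<close>, \<open>q\<close>,
    \<open>r\<close> the exponents of \<open>U * X\<close>, \<open>X\<close>,
    \<open>X * (U * X)\<close>.\<close>
  define t where "t p q r = int (pS (j + 1 - int p - int r) (i + j + 3 - int p - int q - 2 * int r))"
    for p q r
  have cf_t: "cf ((U * X) ^ p * X ^ q * (X * (U * X)) ^ r * pS_gf) (j + 1) (i + j + 3) = t p q r" for p q r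
    by (simp only: cf_monomial cf_pS_gf t_def)
  let ?k = "l1 + 3" and ?l = "l2 + 2" and ?m = "l3 + 1" and ?n = l4
  have zero: "t p q r = 0" if "j + 1 < int p + int r \<or> i + j + 3 < int p + int q + 2 * int r" for p q r
    using that by (auto simp: t_def pS_def)
  \<comment> \<open>Each entry with free \<open>q\<close> covers two terms and has a negative first
    argument because \<open>2 * j \<le> d\<close>; the other five have a negative second argument
    because \<open>i + j \<le> d\<close>.\<close>
  have zeros: "t ?k q ?m = 0" "t ?m q ?k = 0" "t ?k q ?l = 0" "t ?l q ?k = 0"
      "t ?n ?k ?l = 0" "t ?m ?k ?l = 0" "t ?l ?k ?m = 0" "t ?n ?l ?k = 0" "t ?n ?m ?k = 0" for q
    using assms l_ge by (auto intro!: zero)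
  \<comment> \<open>Within a pair the first arguments agree, and \<open>j \<le> i\<close> puts both
    second arguments in the stable range.\<close>
  have cancel: "t ?m ?n ?l = t ?l ?n ?m" "t ?k ?m ?n = t ?k ?l ?n"
    using assms l_ge unfolding t_def by (auto intro!: arg_cong[where f = int] pS_stable simp: algebra_simps)
  have "g i j = t ?m ?l ?n - t ?n ?l ?m - t ?m ?k ?n + t ?n ?k ?m - t ?l ?m ?n + t ?n ?m ?l + t ?l ?k ?n"
    unfolding g_eq_cf_alt4 alt4_one_mult by (simp only: cf_add cf_diff cf_t zeros cancel)
  then show ?thesis unfolding t_def by (simp add: algebra_simps)
qed

lemma N_neg: "N (- 1) j = 0" "N i (- 1) = 0"
  by (simp_all add: tab_count_def)

text \<open>Every cell carries exactly one x and one y, so the exponents of index 0 are the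
  complements of \<open>xdeg\<close> and \<open>ydeg\<close> in \<open>d\<close>.\<close>

lemma schur_subst_coeff_eq:
  "int (schur_subst_coeff lam 2 2 a b) =
    (if a 0 + a 1 = d \<and> b 0 + b 1 = d then N (int (a 1)) (int (b 1)) else 0)"
proof -
  have compl: "card {c \<in> cells lam. \<not> P c} = d - card {c \<in> cells lam. P c}" for P
    using card_cells_not[of lam P] by (simp add: add.assoc)
  have *: "((\<forall>i<2. card {c \<in> cells lam. T (fst c) (snd c) div 2 = i} = a i) \<and>
        (\<forall>j<2. card {c \<in> cells lam. T (fst c) (snd c) mod 2 = j} = b j)) \<longleftrightarrow>
      a 0 + a 1 = d \<and> b 0 + b 1 = d \<and> xdeg lam T = a 1 \<and> ydeg lam T = b 1"
    if T: "T \<in> ssyt lam 4" for T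
  proof -
    have lt: "T (fst c) (snd c) < 4" if "c \<in> cells lam" for c
      using ssyt_lt[OF T] that by (cases c) auto
    have "{c \<in> cells lam. T (fst c) (snd c) div 2 = 0} = {c \<in> cells lam. \<not> T (fst c) (snd c) div 2 = 1}"
    proof -
      have "T (fst c) (snd c) div 2 = 0 \<longleftrightarrow> \<not> T (fst c) (snd c) div 2 = 1" if "c \<in> cells lam" for c
        using lt[OF that] by auto
      then show ?thesis by blast
    qed
    then have x0: "card {c \<in> cells lam. T (fst c) (snd c) div 2 = 0} = d - xdeg lam T"
      by (simp only: compl xdeg_def)
    have "{c \<in> cells lam. T (fst c) (snd c) mod 2 = 0} = {c \<in> cells lam. \<not> T (fst c) (snd c) mod 2 = 1}"
      by auto
    then have y0: "card {c \<in> cells lam. T (fst c) (snd c) mod 2 = 0} = d - ydeg lam T"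
      by (simp only: compl ydeg_def)
    have le: "xdeg lam T \<le> d" "ydeg lam T \<le> d"
      using xdeg_le[of lam T] ydeg_le[of lam T] by simp_all
    show ?thesis unfolding all_less_2 x0 y0 xdeg_def[symmetric] ydeg_def[symmetric] using le by auto
  qed
  have "schur_subst_coeff lam 2 2 a b = card {T \<in> ssyt lam 4.
      a 0 + a 1 = d \<and> b 0 + b 1 = d \<and> xdeg lam T = a 1 \<and> ydeg lam T = b 1}"
    unfolding schur_subst_coeff_def using *
    by (intro arg_cong[where f = card]) auto
  then show ?thesis by (auto simp: tab_count_def)
qed

end

section \<open>Kronecker coefficients\<close>

text \<open>The total degree is \<open>e\<close>, so setting the first variable to 1 loses nothing;
  \<open>schur_2\<close> then yields a sum of distinct powers.\<close>

lemma schur_coeff_two_rows: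
  assumes "2 * i \<le> e"
  shows "schur_coeff [e - i, i] 2 a = of_bool (a 0 + a 1 = e \<and> i \<le> a 0 \<and> i \<le> a 1)"
proof -
  let ?p = "[e - i, i]"
  have e: "sum_list ?p = e" using assms by simp
  define w where "w T = card {c \<in> cells ?p. T (fst c) (snd c) = 1}" for T :: "nat \<Rightarrow> nat \<Rightarrow> nat"
  have w_le: "w T \<le> e" for T
    unfolding w_def by (subst e[symmetric], subst card_cells[symmetric], rule card_mono) auto
  let ?z = "\<lambda>k. if k = 1 then fps_X else (1 :: int fps)"
  have tw: "tab_weight ?p ?z T = fps_X ^ w T" for T
    unfolding tab_weight_def w_def by (subst prod_if_const) simp_all
  have "fps_nth (schur ?p 2 ?z) n = (\<Sum>T\<in>ssyt ?p 2. of_bool (n = w T))" for n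
    unfolding schur_def tw by (simp add: fps_sum_nth of_bool_def)
  then have 1: "fps_nth (schur ?p 2 ?z) n = int (card {T \<in> ssyt ?p 2. n = w T})" for n
    using finite_ssyt by (simp add: of_bool_def sum.inter_filter[symmetric])
  have "schur ?p 2 ?z = (\<Sum>q=i..e - i. fps_X ^ (e - q))"
  proof -
    have "schur ?p 2 ?z = (\<Sum>q=i..e - i. fps_X ^ (e - i - q) * fps_X ^ i)"
      using assms by (subst schur_2) simp_all
    also have "\<dots> = (\<Sum>q=i..e - i. fps_X ^ (e - q))"
      using assms by (intro sum.cong refl) (auto simp flip: power_add intro: arg_cong[where f = "\<lambda>n. fps_X ^ n"])
    finally show ?thesis .
  qed
  then have schur: "fps_nth (schur ?p 2 ?z) n = (\<Sum>q=i..e - i. of_bool (n = e - q))" for n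
    by (simp add: fps_sum_nth of_bool_def)
  have 2: "card {T \<in> ssyt ?p 2. n = w T} = of_bool (i \<le> n \<and> n \<le> e - i)" for n
  proof -
    have "int (card {T \<in> ssyt ?p 2. n = w T}) =
        (\<Sum>q=i..e - i. if q = e - n then of_bool (n \<le> e) else 0)"
      unfolding 1[symmetric] schur using assms by (intro sum.cong refl) auto
    also have "\<dots> = of_bool (i \<le> n \<and> n \<le> e - i)"
      using assms by auto
    finally show ?thesis by (simp add: of_bool_def split: if_splits)
  qed
  have *: "(\<forall>k<2. card {c \<in> cells ?p. T (fst c) (snd c) = k} = a k) \<longleftrightarrow> a 0 + a 1 = e \<and> a 1 = w T"
    if T: "T \<in> ssyt ?p 2" for T
  proof -
    have lt: "T (fst c) (snd c) < 2" if "c \<in> cells ?p" for c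
      using ssyt_lt[OF T] that by (cases c) auto
    have "{c \<in> cells ?p. T (fst c) (snd c) = 0} = {c \<in> cells ?p. \<not> T (fst c) (snd c) = 1}"
    proof -
      have "T (fst c) (snd c) = 0 \<longleftrightarrow> \<not> T (fst c) (snd c) = 1" if "c \<in> cells ?p" for c
        using lt[OF that] by auto
      then show ?thesis by blast
    qed
    then have 0: "card {c \<in> cells ?p. T (fst c) (snd c) = 0} = e - w T"
      by (simp only: w_def card_cells_not e)
    show ?thesis unfolding all_less_2 0 w_def[symmetric] using w_le[of T] by auto
  qed
  have "schur_coeff ?p 2 a = card {T \<in> ssyt ?p 2. a 0 + a 1 = e \<and> a 1 = w T}"
    unfolding schur_coeff_def using * by (intro arg_cong[where f = card]) auto
  also have "\<dots> = of_bool (a 0 + a 1 = e \<and> i \<le> a 0 \<and> i \<le> a 1)"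
    using 2[of "a 1"] assms by (cases "a 0 + a 1 = e") auto
  finally show ?thesis .
qed

lemma partitions_2: "partitions 2 e = (\<lambda>i. [e - i, i]) ` {..e div 2}"
proof (intro equalityI subsetI)
  fix p assume "p \<in> partitions 2 e"
  then obtain x y where "p = [x, y]" "y \<le> x" "x + y = e"
    by (auto simp: partitions_def length_Suc_conv numeral_2_eq_2)
  then show "p \<in> (\<lambda>i. [e - i, i]) ` {..e div 2}" by (intro image_eqI[of _ _ y]) auto
qed (auto simp: partitions_def)

lemma sum_partitions_2: "sum f (partitions 2 e) = (\<Sum>i\<le>e div 2. f [e - i, i])"
  unfolding partitions_2 by (subst sum.reindex) (auto simp: inj_on_def)

text \<open>As two-row Kostka numbers are 0 or 1, the coefficients of a Schur expansion are prefix
  sums.\<close>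

lemma sum_two_rows:
  fixes f :: "nat \<Rightarrow> int"
  shows "(\<Sum>i\<le>e div 2. f i * int (schur_coeff [e - i, i] 2 a)) =
    (if a 0 + a 1 = e then \<Sum>i\<le>min (a 0) (a 1). f i else 0)"
proof -
  have "(\<Sum>i\<le>e div 2. f i * int (schur_coeff [e - i, i] 2 a)) =
      (\<Sum>i\<le>e div 2. if a 0 + a 1 = e \<and> i \<le> min (a 0) (a 1) then f i else 0)"
    by (intro sum.cong refl) (auto simp: schur_coeff_two_rows)
  also have "\<dots> = (if a 0 + a 1 = e then \<Sum>i\<le>min (a 0) (a 1). f i else 0)"
  proof (cases "a 0 + a 1 = e")
    case True
    then have "{i. i \<le> e div 2 \<and> i \<le> min (a 0) (a 1)} = {..min (a 0) (a 1)}" by auto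
    with True show ?thesis by (simp add: sum.inter_filter[symmetric])
  qed simp
  finally show ?thesis .
qed

lemma sum_two_rows2:
  fixes f :: "nat list \<Rightarrow> nat list \<Rightarrow> int"
  shows "(\<Sum>mu\<in>partitions 2 e. \<Sum>nu\<in>partitions 2 e.
      f mu nu * int (schur_coeff mu 2 a) * int (schur_coeff nu 2 b)) =
    (if a 0 + a 1 = e \<and> b 0 + b 1 = e
     then \<Sum>i\<le>min (a 0) (a 1). \<Sum>j\<le>min (b 0) (b 1). f [e - i, i] [e - j, j] else 0)"
proof -
  have "(\<Sum>mu\<in>partitions 2 e. \<Sum>nu\<in>partitions 2 e.
      f mu nu * int (schur_coeff mu 2 a) * int (schur_coeff nu 2 b)) =
    (\<Sum>i\<le>e div 2. (\<Sum>j\<le>e div 2. f [e - i, i] [e - j, j] * int (schur_coeff [e - j, j] 2 b))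
      * int (schur_coeff [e - i, i] 2 a))"
    unfolding sum_partitions_2 sum_distrib_right by (intro sum.cong refl) simp
  then show ?thesis unfolding sum_two_rows by auto
qed

lemma prefix_sums_eq_imp_eq:
  fixes f h :: "nat \<Rightarrow> int"
  assumes "\<And>I. I \<le> M \<Longrightarrow> (\<Sum>i\<le>I. f i) = (\<Sum>i\<le>I. h i)" and "i \<le> M"
  shows "f i = h i"
  using assms(1)[of i] assms(1)[of "i - 1"] assms(2) by (cases i) auto

lemma sum_backward_differences:
  fixes F :: "int \<Rightarrow> int"
  shows "(\<Sum>i\<le>n. F (int i) - F (int i - 1)) = F (int n) - F (- 1)"
  by (induction n) auto

section \<open>Existence and uniqueness of the Kronecker expansion\<close>

context four_row_partition
begin

text \<open>Telescoping in both directions; the boundary terms vanish because no tableau has degree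
  -1.\<close>

lemma sum_g: "(\<Sum>i\<le>I. \<Sum>j\<le>J. g (int i) (int j)) = N (int I) (int J)"
proof -
  have "(\<Sum>j\<le>J. g (int i) (int j)) = N (int i) (int J) - N (int i - 1) (int J)" for i
    using sum_backward_differences[of "\<lambda>j. N (int i) j - N (int i - 1) j" J]
    by (simp add: g_def N_neg)
  then show ?thesis
    using sum_backward_differences[of "\<lambda>i. N i (int J)" I] by (simp add: N_neg)
qed

lemma N_min:
  assumes "a0 + a1 = d" "b0 + b1 = d"
  shows "N (int (min a0 a1)) (int (min b0 b1)) = N (int a1) (int b1)"
proof -
  have a: "int a0 = int d - int a1" and b: "int b0 = int d - int b1" using assms by linarith+
  show ?thesis
    by (cases "a0 \<le> a1"; cases "b0 \<le> b1")
      (simp_all only: min_absorb1 min_absorb2 nat_le_linear linear min_def if_True if_False a b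
        N_symmetric_x N_symmetric_y)
qed

definition kron_fun :: "nat list \<Rightarrow> nat list \<Rightarrow> int" where
  "kron_fun mu nu =
    (if mu \<in> partitions 2 d \<and> nu \<in> partitions 2 d then g (int (mu ! 1)) (int (nu ! 1)) else 0)"

text \<open>The property inside the definite description of \<open>kron\<close>, at
  \<open>n = m = 2\<close>.\<close>

definition is_kron :: "(nat list \<Rightarrow> nat list \<Rightarrow> int) \<Rightarrow> bool" where
  "is_kron f \<longleftrightarrow>
    (\<forall>mu nu. mu \<notin> partitions 2 (sum_list lam) \<or> nu \<notin> partitions 2 (sum_list lam) \<longrightarrow> f mu nu = 0) \<and>
    (\<forall>a b. int (schur_subst_coeff lam 2 2 a b) =
      (\<Sum>mu\<in>partitions 2 (sum_list lam). \<Sum>nu\<in>partitions 2 (sum_list lam).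
        f mu nu * int (schur_coeff mu 2 a) * int (schur_coeff nu 2 b)))"

lemma sum_lam: "sum_list lam = d" by simp

lemma in_partitions: "i \<le> d div 2 \<Longrightarrow> [d - i, i] \<in> partitions 2 d"
  unfolding partitions_2 by blast

lemma is_kron_kron_fun: "is_kron kron_fun"
proof -
  have "int (schur_subst_coeff lam 2 2 a b) =
      (\<Sum>mu\<in>partitions 2 d. \<Sum>nu\<in>partitions 2 d.
        kron_fun mu nu * int (schur_coeff mu 2 a) * int (schur_coeff nu 2 b))" for a b
  proof (cases "a 0 + a 1 = d \<and> b 0 + b 1 = d")
    case True
    have "kron_fun [d - i, i] [d - j, j] = g (int i) (int j)"
      if "i \<le> min (a 0) (a 1)" "j \<le> min (b 0) (b 1)" for i j
    proof -
      have "i \<le> d div 2" "j \<le> d div 2" using that True by linarith+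
      then show ?thesis using in_partitions by (simp add: kron_fun_def)
    qed
    then have "(\<Sum>i\<le>min (a 0) (a 1). \<Sum>j\<le>min (b 0) (b 1). kron_fun [d - i, i] [d - j, j]) =
        (\<Sum>i\<le>min (a 0) (a 1). \<Sum>j\<le>min (b 0) (b 1). g (int i) (int j))"
      by (intro sum.cong refl) auto
    also have "\<dots> = N (int (a 1)) (int (b 1))"
      unfolding sum_g using True by (intro N_min) auto
    finally show ?thesis
      unfolding schur_subst_coeff_eq sum_two_rows2 using True by simp
  next
    case False
    then show ?thesis unfolding schur_subst_coeff_eq sum_two_rows2 by (simp only: if_False)
  qed
  then show ?thesis unfolding is_kron_def sum_lam by (simp add: kron_fun_def)
qed

text \<open>The expansion prescribes all double prefix sums of \<open>f\<close>, and differencing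
  recovers \<open>f\<close> itself.\<close>

lemma is_kron_unique:
  assumes "is_kron f"
  shows "f = kron_fun"
proof -
  have sums: "(\<Sum>i\<le>I. \<Sum>j\<le>J. h [d - i, i] [d - j, j]) = N (int I) (int J)"
    if "is_kron h" "I \<le> d div 2" "J \<le> d div 2" for h I J
  proof -
    \<comment> \<open>Exponents chosen so that the two minima are exactly \<open>I\<close> and
      \<open>J\<close>.\<close>
    define a where "a k = (if k = 0 then d - I else I)" for k :: nat
    define b where "b k = (if k = 0 then d - J else J)" for k :: nat
    have ab: "a 0 + a 1 = d" "b 0 + b 1 = d" "min (a 0) (a 1) = I" "min (b 0) (b 1) = J"
        "a 1 = I" "b 1 = J"
      using that(2,3) by (auto simp: a_def b_def)
    have "int (schur_subst_coeff lam 2 2 a b) = (\<Sum>mu\<in>partitions 2 d. \<Sum>nu\<in>partitions 2 d.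
        h mu nu * int (schur_coeff mu 2 a) * int (schur_coeff nu 2 b))"
      using that(1) unfolding is_kron_def sum_lam by blast
    then show ?thesis unfolding schur_subst_coeff_eq sum_two_rows2
      by (simp only: ab(1-4) if_True simp_thms) (simp only: ab(5,6))
  qed
  have eq: "f [d - i, i] [d - j, j] = kron_fun [d - i, i] [d - j, j]"
    if "i \<le> d div 2" "j \<le> d div 2" for i j
  \<comment> \<open>Two nested inversions: first in \<open>j\<close> for fixed \<open>i\<close>,
    then in \<open>i\<close> for the partial sums up to \<open>J\<close>.\<close>
  proof (rule prefix_sums_eq_imp_eq[OF _ that(2)])
    fix J assume J: "J \<le> d div 2"
    show "(\<Sum>j\<le>J. f [d - i, i] [d - j, j]) = (\<Sum>j\<le>J. kron_fun [d - i, i] [d - j, j])"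
      by (rule prefix_sums_eq_imp_eq[OF _ that(1)])
        (simp only: sums[OF assms _ J] sums[OF is_kron_kron_fun _ J])
  qed
  show ?thesis
  proof (intro ext)
    fix mu nu
    show "f mu nu = kron_fun mu nu"
    proof (cases "mu \<in> partitions 2 d \<and> nu \<in> partitions 2 d")
      case True
      then show ?thesis unfolding partitions_2 using eq by auto
    next
      case False
      then show ?thesis using assms unfolding is_kron_def sum_lam by (auto simp: kron_fun_def)
    qed
  qed
qed

lemma kron_eq_g:
  assumes "m1 \<ge> m2" "n1 \<ge> n2" "m1 + m2 = d" "n1 + n2 = d"
  shows "kron 2 2 [m1, m2] [n1, n2] lam = g (int m2) (int n2)"
proof -
  have "kron 2 2 [m1, m2] [n1, n2] lam = (THE f. is_kron f) [m1, m2] [n1, n2]"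
    unfolding kron_def is_kron_def ..
  also have "(THE f. is_kron f) = kron_fun"
    using is_kron_kron_fun is_kron_unique by (rule the_equality)
  finally show ?thesis using assms by (simp add: kron_fun_def partitions_def)
qed

end

theorem theorem3p3:
  fixes l1 l2 l3 l4 m1 m2 n1 n2 :: nat
  assumes "l1 \<ge> l2" "l2 \<ge> l3" "l3 \<ge> l4"
    and "m1 \<ge> m2" and "n1 \<ge> n2"
    and "l1 + l2 + l3 + l4 = m1 + m2" and "m1 + m2 = n1 + n2"
    and "m2 \<ge> n2"
  shows "kron 2 2 [m1, m2] [n1, n2] [l1, l2, l3, l4] =
           sum_list (map (\<lambda>(c, a, b). c * int (Fbar_coeff (int m2 - a) (int n2 - b)))
                         (Plam l1 l2 l3 l4))
    \<and> (\<forall>(c, a, b) \<in> set (Plam l1 l2 l3 l4).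
          Fbar_coeff (int m2 - a) (int n2 - b) \<noteq> 0 \<longleftrightarrow> b \<le> int n2 \<and> a + b \<le> int m2 + int n2)
    \<and> kron 2 2 [m1, m2] [n1, n2] [l1, l2, l3, l4] =
          int (pS (int n2 - (int l3 + int l4)) (int n2 - (int l3 + int l4) + int m2 - (int l2 + int l4)))
        - int (pS (int n2 - (int l3 + int l4)) (int n2 - (int l3 + int l4) + int m2 - (int l2 + int l3 + 1)))
        - int (pS (int n2 - (int l3 + int l4)) (int n2 - (int l3 + int l4) + int m2 - (int l1 + int l4 + 1)))
        + int (pS (int n2 - (int l3 + int l4)) (int n2 - (int l3 + int l4) + int m2 - (int l1 + int l3 + 2)))
        - int (pS (int n2 - (int l2 + int l4 + 1)) (int n2 - (int l2 + int l4 + 1) + int m2 - (int l3 + int l4 - 1)))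
        + int (pS (int n2 - (int l2 + int l4 + 1)) (int n2 - (int l2 + int l4 + 1) + int m2 - (int l2 + int l3 + 1)))
        + int (pS (int n2 - (int l2 + int l4 + 1)) (int n2 - (int l2 + int l4 + 1) + int m2 - (int l1 + int l4 + 1)))"
proof -
  interpret four_row_partition l1 l2 l3 l4
    using assms by unfold_locales
  have kron: "kron 2 2 [m1, m2] [n1, n2] [l1, l2, l3, l4] = g (int m2) (int n2)"
    using assms by (intro kron_eq_g) auto
  have "int n2 \<le> int m2" "2 * int m2 \<le> int (l1 + l2 + l3 + l4)"
    using assms by linarith+
  note g = g_eq_pS[OF this]
  show ?thesis
  proof (intro conjI)
    show "kron 2 2 [m1, m2] [n1, n2] [l1, l2, l3, l4] =
        sum_list (map (\<lambda>(c, a, b). c * int (Fbar_coeff (int m2 - a) (int n2 - b))) (Plam l1 l2 l3 l4))"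
      unfolding kron g by (simp add: Plam_def Fbar_coeff_eq algebra_simps)
    show "\<forall>(c, a, b) \<in> set (Plam l1 l2 l3 l4).
        Fbar_coeff (int m2 - a) (int n2 - b) \<noteq> 0 \<longleftrightarrow> b \<le> int n2 \<and> a + b \<le> int m2 + int n2"
      \<comment> \<open>The two inequalities say that both arguments of \<open>pS\<close> are
        nonnegative.\<close>
      unfolding Fbar_coeff_eq pS_nonzero_iff by auto
  qed (unfold kron, rule g)
qed

end
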